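(* Let $(e^{tA})_{t\ge 0}$ be a $C_0$-semigroup on a complex Banach lattice $E$ that has the LEP property with respect to an increasing sequence $(P_n)_{n\in\mathbb{N}}$ of positive operators on $E$ converging strongly to the identity. If $s_{\mathrm{ess}}(A)<s(A)$, then $s(A)\in\sigma(A)$.
   Context: A complex Banach lattice $E$ is the complexification of a real Banach lattice $E_{\mathbb{R}}$; $E_+$ is the positive cone of $E_{\mathbb{R}}$. A linear operator $T$ on $E$ is positive if $T(E_+)\subseteq E_+$. A sequence $(P_n)$ of positive operators is increasing if $P_{n+1}-P_n$ is positive for all $n$. The semigroup has the LEP property with respect to $(P_n)$ if for every $n\in\mathbb{N}$ and $f\in E_+\setminus\{0\}$ there exists $\tau>0$ (depending on $n$ and $f$) such that $P_ne^{tA}f\ge 0$ for all $t\ge\tau$. The spectral bound is $s(A)=\sup\{\operatorname{Re}\lambda:\lambda\in\sigma(A)\}$, with $s(A)=-\infty$ if $\sigma(A)=\emptyset$. A closed densely defined operator is Fredholm if its kernel is finite-dimensional and its range has finite codimension. The essential spectrum is $\sigma_{\mathrm{ess}}(A)=\{\lambda\in\mathbb{C}: A-\lambda I\text{ is not Fredholm}\}$, and the essential spectral bound is $s_{\mathrm{ess}}(A)=\sup\{\operatorname{Re}\lambda:\lambda\in\sigma_{\mathrm{ess}}(A)\}\in[-\infty,\infty]$ (equal to $-\infty$ if $\sigma_{\mathrm{ess}}(A)=\emptyset$). *)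

theory Defs
  imports "HOL-Analysis.Analysis" "HOL-Library.Lattice_Algebras"
begin

section \<open>Real Banach lattices\<close>

class real_banach_lattice = banach + ordered_real_vector + lattice_ab_group_add_abs +
  assumes lattice_norm_mono: "\<bar>x\<bar> \<le> \<bar>y\<bar> \<Longrightarrow> norm x \<le> norm y"

lemma abs_scaleR_le: "\<bar>r *\<^sub>R x\<bar> \<le> \<bar>r\<bar> *\<^sub>R \<bar>x\<bar>" for x :: "'a::real_banach_lattice"
proof (rule abs_leI)
  have 1: "s *\<^sub>R x \<le> \<bar>s\<bar> *\<^sub>R \<bar>x\<bar>" for s
  proof (cases "0 \<le> s")
    case True
    then show ?thesis using scaleR_left_mono[OF abs_ge_self[of x] True] by simp
  next
    case False
    then have "(-s) *\<^sub>R (-x) \<le> (-s) *\<^sub>R \<bar>x\<bar>"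
      by (intro scaleR_left_mono[OF abs_ge_minus_self]) linarith
    then show ?thesis using False by simp
  qed
  show "r *\<^sub>R x \<le> \<bar>r\<bar> *\<^sub>R \<bar>x\<bar>" by (rule 1)
  show "- (r *\<^sub>R x) \<le> \<bar>r\<bar> *\<^sub>R \<bar>x\<bar>" using 1[of "-r"] by simp
qed

lemma norm_lattice_abs [simp]: "norm \<bar>x\<bar> = norm x" for x :: "'a::real_banach_lattice"
  by (rule antisym; rule lattice_norm_mono) (simp_all only: abs_idempotent order_refl)

lemma norm_mono_nonneg: "0 \<le> x \<Longrightarrow> x \<le> y \<Longrightarrow> norm x \<le> norm y"
  for x :: "'a::real_banach_lattice"
  by (rule lattice_norm_mono) (simp only: abs_of_nonneg order_trans[of 0 x y])

lemma lattice_nonneg_limit: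
  fixes X :: "nat \<Rightarrow> 'a::real_banach_lattice"
  assumes "X \<longlonglongrightarrow> x" and "\<And>n. 0 \<le> X n"
  shows "0 \<le> x"
proof -
  have "norm (\<bar>X n\<bar> - \<bar>x\<bar>) \<le> norm (X n - x)" for n
    by (intro lattice_norm_mono abs_triangle_ineq3)
  moreover have "(\<lambda>n. norm (X n - x)) \<longlonglongrightarrow> 0"
    using assms(1) by (simp add: LIM_zero_iff tendsto_norm_zero)
  ultimately have "(\<lambda>n. \<bar>X n\<bar> - \<bar>x\<bar>) \<longlonglongrightarrow> 0"
    by (rule Lim_null_comparison[OF always_eventually[OF allI]])
  then have "X \<longlonglongrightarrow> \<bar>x\<bar>"
    using assms(2) by (simp add: LIM_zero_iff)
  then have "x = \<bar>x\<bar>" using assms(1) LIMSEQ_unique by blast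
  then show ?thesis using abs_ge_zero[of x] by (rule ssubst)
qed

lemma lattice_le_limit:
  fixes X Y :: "nat \<Rightarrow> 'a::real_banach_lattice"
  assumes "X \<longlonglongrightarrow> x" "Y \<longlonglongrightarrow> y" and "\<And>n. X n \<le> Y n"
  shows "x \<le> y"
proof -
  have "(\<lambda>n. Y n - X n) \<longlonglongrightarrow> y - x" using assms by (intro tendsto_diff)
  then have "0 \<le> y - x" by (rule lattice_nonneg_limit) (use assms(3) in simp)
  then show ?thesis by simp
qed


section \<open>Complexification\<close>

datatype 'a complexification = Cx (re_part: 'a) (im_part: 'a)

lemma complexification_eq_iff:
  "z = w \<longleftrightarrow> re_part z = re_part w \<and> im_part z = im_part w"
  by (cases z; cases w) auto

instantiation complexification :: (ab_group_add) ab_group_add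
begin
definition "0 = Cx 0 0"
definition "z + w = Cx (re_part z + re_part w) (im_part z + im_part w)"
definition "z - w = Cx (re_part z - re_part w) (im_part z - im_part w)"
definition "- z = Cx (- re_part z) (- im_part z)"
instance
  by standard (auto simp: complexification_eq_iff zero_complexification_def
      plus_complexification_def minus_complexification_def uminus_complexification_def)
end

lemma parts_simps [simp]:
  "re_part 0 = 0" "im_part 0 = 0"
  "re_part (z + w) = re_part z + re_part w" "im_part (z + w) = im_part z + im_part w"
  "re_part (z - w) = re_part z - re_part w" "im_part (z - w) = im_part z - im_part w"
  "re_part (- z) = - re_part z" "im_part (- z) = - im_part z"
  by (simp_all add: zero_complexification_def plus_complexification_def
      minus_complexification_def uminus_complexification_def)

definition scaleC :: "complex \<Rightarrow> 'a::real_vector complexification \<Rightarrow> 'a complexification"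
    (infixr "*\<^sub>C" 75)
  where "c *\<^sub>C z = Cx (Re c *\<^sub>R re_part z - Im c *\<^sub>R im_part z)
                      (Re c *\<^sub>R im_part z + Im c *\<^sub>R re_part z)"

lemma parts_scaleC [simp]:
  "re_part (c *\<^sub>C z) = Re c *\<^sub>R re_part z - Im c *\<^sub>R im_part z"
  "im_part (c *\<^sub>C z) = Re c *\<^sub>R im_part z + Im c *\<^sub>R re_part z"
  by (simp_all add: scaleC_def)

global_interpretation complexification: vector_space
    "scaleC :: complex \<Rightarrow> 'a::real_vector complexification \<Rightarrow> 'a complexification"
  defines cspan = complexification.span
    and csubspace = complexification.subspace
  by standard (auto simp: complexification_eq_iff algebra_simps)

instantiation complexification :: (real_vector) real_vector
begin
definition "r *\<^sub>R z = complex_of_real r *\<^sub>C z"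
instance
  by standard (auto simp: complexification_eq_iff scaleR_complexification_def algebra_simps)
end

lemma parts_scaleR [simp]:
  "re_part (r *\<^sub>R z) = r *\<^sub>R re_part z" "im_part (r *\<^sub>R z) = r *\<^sub>R im_part z"
  by (simp_all add: scaleR_complexification_def)

text \<open>The modulus of \<open>z = x + iy\<close> is the supremum of \<open>\<bar>(cos \<theta>) x + (sin \<theta>) y\<bar>\<close> over all
  angles \<open>\<theta>\<close>; that it exists in every Banach lattice is \<open>modulus_exists\<close> below. The norm of
  the complexification is the lattice norm of the modulus.\<close>

definition modulus :: "'a::real_banach_lattice complexification \<Rightarrow> 'a"
  where "modulus z = (THE m.
    (\<forall>\<theta>. \<bar>cos \<theta> *\<^sub>R re_part z + sin \<theta> *\<^sub>R im_part z\<bar> \<le> m) \<and>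
    (\<forall>u. (\<forall>\<theta>. \<bar>cos \<theta> *\<^sub>R re_part z + sin \<theta> *\<^sub>R im_part z\<bar> \<le> u) \<longrightarrow> m \<le> u))"

lemma cos_sin_lipschitz:
  "\<bar>cos s - cos t\<bar> \<le> \<bar>s - t\<bar>" "\<bar>sin s - sin t\<bar> \<le> \<bar>s - t\<bar>" for s t :: real
proof -
  have aux: "\<bar>2 * a * b\<bar> \<le> \<bar>s - t\<bar>" if "\<bar>a\<bar> \<le> 1" "\<bar>b\<bar> \<le> \<bar>(s - t) / 2\<bar>" for a b :: real
  proof -
    have "\<bar>a\<bar> * \<bar>b\<bar> \<le> 1 * \<bar>(s - t) / 2\<bar>" using that by (intro mult_mono) auto
    then show ?thesis by (simp add: abs_mult)
  qed
  have 1: "\<bar>sin ((t - s) / 2)\<bar> \<le> \<bar>(s - t) / 2\<bar>" "\<bar>sin ((s - t) / 2)\<bar> \<le> \<bar>(s - t) / 2\<bar>"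
    using abs_sin_x_le_abs_x[of "(t - s) / 2"] abs_sin_x_le_abs_x[of "(s - t) / 2"] by auto
  show "\<bar>cos s - cos t\<bar> \<le> \<bar>s - t\<bar>"
    unfolding cos_diff_cos by (intro aux 1) auto
  have "\<bar>2 * cos ((s + t) / 2) * sin ((s - t) / 2)\<bar> \<le> \<bar>s - t\<bar>"
    by (intro aux 1) auto
  then show "\<bar>sin s - sin t\<bar> \<le> \<bar>s - t\<bar>"
    unfolding sin_diff_sin by (simp add: mult_ac)
qed

lemma modulus_exists:
  fixes x y :: "'a::real_banach_lattice"
  obtains m where "\<And>\<theta>. \<bar>cos \<theta> *\<^sub>R x + sin \<theta> *\<^sub>R y\<bar> \<le> m"
    and "\<And>u. (\<And>\<theta>. \<bar>cos \<theta> *\<^sub>R x + sin \<theta> *\<^sub>R y\<bar> \<le> u) \<Longrightarrow> m \<le> u"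
proof -
  define f where "f \<theta> = \<bar>cos \<theta> *\<^sub>R x + sin \<theta> *\<^sub>R y\<bar>" for \<theta> :: real
  define v where "v = \<bar>x\<bar> + \<bar>y\<bar>"
  define e where "e n = 1 / real (Suc n)" for n
  define S where "S n = (\<lambda>k. f (real k / real (Suc n))) ` {0..8 * Suc n}" for n
  define M where "M n = Sup_fin (S n)" for n
  have v0: "0 \<le> v" by (simp add: v_def)
  have lip: "f s \<le> f t + \<bar>s - t\<bar> *\<^sub>R v" for s t
  proof -
    have "f s - f t \<le> \<bar>(cos s *\<^sub>R x + sin s *\<^sub>R y) - (cos t *\<^sub>R x + sin t *\<^sub>R y)\<bar>"
      unfolding f_def by (rule abs_triangle_ineq2)
    also have "\<dots> = \<bar>(cos s - cos t) *\<^sub>R x + (sin s - sin t) *\<^sub>R y\<bar>"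
      by (simp add: algebra_simps)
    also have "\<dots> \<le> \<bar>cos s - cos t\<bar> *\<^sub>R \<bar>x\<bar> + \<bar>sin s - sin t\<bar> *\<^sub>R \<bar>y\<bar>"
      by (rule order_trans[OF abs_triangle_ineq add_mono[OF abs_scaleR_le abs_scaleR_le]])
    also have "\<dots> \<le> \<bar>s - t\<bar> *\<^sub>R \<bar>x\<bar> + \<bar>s - t\<bar> *\<^sub>R \<bar>y\<bar>"
      by (intro add_mono scaleR_right_mono cos_sin_lipschitz) auto
    finally show ?thesis by (simp add: v_def algebra_simps)
  qed
  have finS: "finite (S n)" "S n \<noteq> {}" for n by (auto simp: S_def)
  have approx: "f \<theta> \<le> M n + e n *\<^sub>R v" for \<theta> n
  proof -
    obtain t where t: "0 \<le> t" "t < 2 * pi" "cos \<theta> = cos t" "sin \<theta> = sin t"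
      using sincos_total_2pi[of "cos \<theta>" "sin \<theta>"] by auto
    define k where "k = nat \<lfloor>t * real (Suc n)\<rfloor>"
    have kr: "real k = of_int \<lfloor>t * real (Suc n)\<rfloor>"
      using t(1) by (simp add: k_def)
    have k1: "real k \<le> t * real (Suc n)" unfolding kr by linarith
    have k2: "t * real (Suc n) \<le> real k + 1" unfolding kr by linarith
    have "t \<le> 8" using t(2) pi_less_4 by linarith
    then have "real k \<le> 8 * real (Suc n)"
      using k1 by (meson mult_right_mono of_nat_0_le_iff order_trans)
    then have "real k \<le> real (8 * Suc n)" by simp
    then have kS: "k \<in> {0..8 * Suc n}" by (simp only: of_nat_le_iff atLeastAtMost_iff) simp
    have "\<bar>t - real k / real (Suc n)\<bar> \<le> e n"
    proof -
      have "t - real k / real (Suc n) = (t * real (Suc n) - real k) / real (Suc n)"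
        by (simp add: diff_divide_distrib del: of_nat_Suc)
      moreover have "\<bar>t * real (Suc n) - real k\<bar> \<le> 1" using k1 k2 by linarith
      ultimately show ?thesis by (simp add: e_def divide_right_mono del: of_nat_Suc)
    qed
    then have "\<bar>t - real k / real (Suc n)\<bar> *\<^sub>R v \<le> e n *\<^sub>R v"
      by (rule scaleR_right_mono[OF _ v0])
    moreover have "f (real k / real (Suc n)) \<le> M n"
      unfolding M_def using kS by (intro Sup_fin.coboundedI finS) (auto simp: S_def)
    ultimately have "f t \<le> M n + e n *\<^sub>R v"
      by (meson lip add_mono order_trans)
    moreover have "f \<theta> = f t" by (simp add: f_def t)
    ultimately show ?thesis by simp
  qed
  have Mle: "M n \<le> u" if "\<And>\<theta>. f \<theta> \<le> u" for n u
    unfolding M_def using that by (intro Sup_fin.boundedI finS) (auto simp: S_def)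
  have e0: "0 \<le> e n" for n by (simp add: e_def)
  have elim: "e \<longlonglongrightarrow> 0"
    unfolding e_def by (rule lim_const_over_n[THEN LIMSEQ_Suc])
  have dist: "norm (M p - M n) \<le> (e n + e p) * norm v" for n p
  proof -
    have "M p \<le> M n + e n *\<^sub>R v" "M n \<le> M p + e p *\<^sub>R v"
      by (intro Mle approx)+
    moreover have "e n *\<^sub>R v \<le> (e n + e p) *\<^sub>R v" "e p *\<^sub>R v \<le> (e n + e p) *\<^sub>R v"
      using e0 v0 by (auto intro!: scaleR_right_mono)
    ultimately have "M p \<le> M n + (e n + e p) *\<^sub>R v" "M n \<le> M p + (e n + e p) *\<^sub>R v"
      by (meson add_left_mono order_trans)+
    then have "\<bar>M p - M n\<bar> \<le> (e n + e p) *\<^sub>R v"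
      by (intro abs_leI) (simp_all add: algebra_simps)
    then have "norm \<bar>M p - M n\<bar> \<le> norm ((e n + e p) *\<^sub>R v)"
      by (intro norm_mono_nonneg) auto
    then show ?thesis using e0 by simp
  qed
  have "Cauchy M"
  proof (rule metric_CauchyI)
    fix d :: real assume "0 < d"
    have "(\<lambda>n. e n * norm v) \<longlonglongrightarrow> 0 * norm v" using elim by (intro tendsto_intros)
    then have "eventually (\<lambda>n. e n * norm v < d / 2) sequentially"
      by (intro order_tendstoD) (use \<open>0 < d\<close> in auto)
    then obtain N where N: "\<And>n. N \<le> n \<Longrightarrow> e n * norm v < d / 2"
      by (auto simp: eventually_sequentially)
    show "\<exists>N. \<forall>m\<ge>N. \<forall>n\<ge>N. dist (M m) (M n) < d"
    proof (intro exI allI impI)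
      fix m n assume mn: "N \<le> m" "N \<le> n"
      have "dist (M m) (M n) \<le> e n * norm v + e m * norm v"
        using dist[of m n] by (simp add: dist_norm algebra_simps)
      also have "\<dots> < d" using N[OF mn(1)] N[OF mn(2)] by linarith
      finally show "dist (M m) (M n) < d" .
    qed
  qed
  then obtain m where m: "M \<longlonglongrightarrow> m" by (auto simp: Cauchy_convergent_iff convergent_def)
  have "(\<lambda>n. M n + e n *\<^sub>R v) \<longlonglongrightarrow> m + 0 *\<^sub>R v" using m elim by (intro tendsto_intros)
  then have lim: "(\<lambda>n. M n + e n *\<^sub>R v) \<longlonglongrightarrow> m" by simp
  show ?thesis
  proof (rule that)
    show "\<bar>cos \<theta> *\<^sub>R x + sin \<theta> *\<^sub>R y\<bar> \<le> m" for \<theta>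
      using lattice_le_limit[OF tendsto_const lim approx[of \<theta>]] by (simp add: f_def)
    show "m \<le> u" if "\<And>\<theta>. \<bar>cos \<theta> *\<^sub>R x + sin \<theta> *\<^sub>R y\<bar> \<le> u" for u
      by (rule lattice_le_limit[OF m tendsto_const]) (rule Mle, use that in \<open>simp add: f_def\<close>)
  qed
qed

lemma modulus_props:
  fixes z :: "'a::real_banach_lattice complexification"
  shows modulus_upper: "\<bar>cos \<theta> *\<^sub>R re_part z + sin \<theta> *\<^sub>R im_part z\<bar> \<le> modulus z"
    and modulus_least: "(\<And>\<theta>. \<bar>cos \<theta> *\<^sub>R re_part z + sin \<theta> *\<^sub>R im_part z\<bar> \<le> u) \<Longrightarrow> modulus z \<le> u"
proof -
  obtain m where m: "\<And>\<theta>. \<bar>cos \<theta> *\<^sub>R re_part z + sin \<theta> *\<^sub>R im_part z\<bar> \<le> m"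
    "\<And>u. (\<And>\<theta>. \<bar>cos \<theta> *\<^sub>R re_part z + sin \<theta> *\<^sub>R im_part z\<bar> \<le> u) \<Longrightarrow> m \<le> u"
    using modulus_exists[of "re_part z" "im_part z"] by blast
  have "modulus z = m"
    unfolding modulus_def by (rule the_equality) (use m in \<open>blast intro: antisym\<close>)+
  then show "\<bar>cos \<theta> *\<^sub>R re_part z + sin \<theta> *\<^sub>R im_part z\<bar> \<le> modulus z"
    and "(\<And>\<theta>. \<bar>cos \<theta> *\<^sub>R re_part z + sin \<theta> *\<^sub>R im_part z\<bar> \<le> u) \<Longrightarrow> modulus z \<le> u"
    using m by blast+
qed

lemma abs_parts_le_modulus: "\<bar>re_part z\<bar> \<le> modulus z" "\<bar>im_part z\<bar> \<le> modulus z"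
  using modulus_upper[of 0 z] modulus_upper[of "pi / 2" z] by simp_all

lemma modulus_nonneg [simp]: "0 \<le> modulus z"
  by (rule order_trans[OF abs_ge_zero abs_parts_le_modulus(1)])

lemma modulus_le: "modulus z \<le> \<bar>re_part z\<bar> + \<bar>im_part z\<bar>"
proof (rule modulus_least)
  fix \<theta> :: real
  have "\<bar>cos \<theta> *\<^sub>R re_part z + sin \<theta> *\<^sub>R im_part z\<bar>
      \<le> \<bar>cos \<theta>\<bar> *\<^sub>R \<bar>re_part z\<bar> + \<bar>sin \<theta>\<bar> *\<^sub>R \<bar>im_part z\<bar>"
    by (rule order_trans[OF abs_triangle_ineq add_mono[OF abs_scaleR_le abs_scaleR_le]])
  also have "\<dots> \<le> 1 *\<^sub>R \<bar>re_part z\<bar> + 1 *\<^sub>R \<bar>im_part z\<bar>"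
    by (intro add_mono scaleR_right_mono) auto
  finally show "\<bar>cos \<theta> *\<^sub>R re_part z + sin \<theta> *\<^sub>R im_part z\<bar> \<le> \<bar>re_part z\<bar> + \<bar>im_part z\<bar>"
    by simp
qed

lemma modulus_triangle: "modulus (z + w) \<le> modulus z + modulus w"
proof (rule modulus_least)
  fix \<theta> :: real
  have "\<bar>cos \<theta> *\<^sub>R re_part (z + w) + sin \<theta> *\<^sub>R im_part (z + w)\<bar>
    = \<bar>(cos \<theta> *\<^sub>R re_part z + sin \<theta> *\<^sub>R im_part z) + (cos \<theta> *\<^sub>R re_part w + sin \<theta> *\<^sub>R im_part w)\<bar>"
    by (simp add: algebra_simps)
  also have "\<dots> \<le> modulus z + modulus w"
    by (rule order_trans[OF abs_triangle_ineq add_mono[OF modulus_upper modulus_upper]])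
  finally show "\<bar>cos \<theta> *\<^sub>R re_part (z + w) + sin \<theta> *\<^sub>R im_part (z + w)\<bar> \<le> modulus z + modulus w" .
qed

lemma modulus_scaleC_le: "modulus (c *\<^sub>C z) \<le> cmod c *\<^sub>R modulus z"
proof (rule modulus_least)
  fix \<theta> :: real
  define w where "w = cnj c * cis \<theta>"
  define t where "t = Arg w"
  have w: "w = rcis (cmod c) t"
    using rcis_cmod_Arg[of w] by (simp add: w_def t_def norm_mult)
  have "Re w = Re c * cos \<theta> + Im c * sin \<theta>" "Im w = Re c * sin \<theta> - Im c * cos \<theta>"
    by (simp_all add: w_def)
  then have "cmod c * cos t = Re c * cos \<theta> + Im c * sin \<theta>"
    "cmod c * sin t = Re c * sin \<theta> - Im c * cos \<theta>"
    by (simp_all add: w)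
  note * = this[symmetric]
  have "cos \<theta> *\<^sub>R re_part (c *\<^sub>C z) + sin \<theta> *\<^sub>R im_part (c *\<^sub>C z)
    = (Re c * cos \<theta> + Im c * sin \<theta>) *\<^sub>R re_part z + (Re c * sin \<theta> - Im c * cos \<theta>) *\<^sub>R im_part z"
    by (simp add: algebra_simps)
  also have "\<dots> = cmod c *\<^sub>R (cos t *\<^sub>R re_part z + sin t *\<^sub>R im_part z)"
    by (simp only: * scaleR_add_right scaleR_scaleR)
  finally have "\<bar>cos \<theta> *\<^sub>R re_part (c *\<^sub>C z) + sin \<theta> *\<^sub>R im_part (c *\<^sub>C z)\<bar>
      \<le> \<bar>cmod c\<bar> *\<^sub>R \<bar>cos t *\<^sub>R re_part z + sin t *\<^sub>R im_part z\<bar>"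
    by (simp only: abs_scaleR_le)
  also have "\<dots> \<le> cmod c *\<^sub>R modulus z"
    by (simp add: scaleR_left_mono modulus_upper)
  finally show "\<bar>cos \<theta> *\<^sub>R re_part (c *\<^sub>C z) + sin \<theta> *\<^sub>R im_part (c *\<^sub>C z)\<bar> \<le> cmod c *\<^sub>R modulus z" .
qed

lemma modulus_scaleC: "modulus (c *\<^sub>C z) = cmod c *\<^sub>R modulus z"
proof (cases "c = 0")
  case True
  then show ?thesis
    using modulus_scaleC_le[of c z] by (simp add: antisym)
next
  case False
  have "modulus z = modulus (inverse c *\<^sub>C c *\<^sub>C z)" using False by simp
  also have "\<dots> \<le> inverse (cmod c) *\<^sub>R modulus (c *\<^sub>C z)"
    using modulus_scaleC_le[of "inverse c" "c *\<^sub>C z"] by (simp add: norm_inverse)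
  finally have "cmod c *\<^sub>R modulus z \<le> cmod c *\<^sub>R inverse (cmod c) *\<^sub>R modulus (c *\<^sub>C z)"
    by (rule scaleR_left_mono) simp
  then show ?thesis using False by (intro antisym modulus_scaleC_le) simp
qed

instantiation complexification :: (real_banach_lattice) real_normed_vector
begin

definition norm_complexification_def:
  "norm (z :: 'a complexification) = norm (modulus z)"

definition dist_complexification_def:
  "dist (z :: 'a complexification) w = norm (z - w)"

definition sgn_complexification_def:
  "sgn (z :: 'a complexification) = z /\<^sub>R norm z"

definition uniformity_complexification_def:
  "(uniformity :: ('a complexification \<times> 'a complexification) filter)
    = (INF e\<in>{0<..}. principal {(x, y). dist x y < e})"

definition open_complexification_def:
  "open (U :: 'a complexification set)
    \<longleftrightarrow> (\<forall>x\<in>U. \<forall>\<^sub>F (x', y) in uniformity. x' = x \<longrightarrow> y \<in> U)"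

instance
proof
  fix z w :: "'a complexification" and r :: real and U :: "'a complexification set"
  show "dist z w = norm (z - w)" by (rule dist_complexification_def)
  show "sgn z = z /\<^sub>R norm z" by (rule sgn_complexification_def)
  show "(uniformity :: ('a complexification \<times> 'a complexification) filter)
    = (INF e\<in>{0<..}. principal {(x, y). dist x y < e})"
    by (rule uniformity_complexification_def)
  show "open U \<longleftrightarrow> (\<forall>x\<in>U. \<forall>\<^sub>F (x', y) in uniformity. x' = x \<longrightarrow> y \<in> U)"
    by (rule open_complexification_def)
  show "norm z = 0 \<longleftrightarrow> z = 0"
  proof
    assume "norm z = 0"
    then have "modulus z = 0" by (simp add: norm_complexification_def)
    then show "z = 0"
      using abs_parts_le_modulus[of z] by (simp add: complexification_eq_iff)
  next
    assume "z = 0"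
    then have "modulus z \<le> 0" using modulus_le[of z] by simp
    then show "norm z = 0" by (simp add: norm_complexification_def antisym)
  qed
  show "norm (z + w) \<le> norm z + norm w"
    unfolding norm_complexification_def
    by (rule order_trans[OF norm_mono_nonneg[OF modulus_nonneg modulus_triangle] norm_triangle_ineq])
  show "norm (r *\<^sub>R z) = \<bar>r\<bar> * norm z"
    by (simp add: norm_complexification_def scaleR_complexification_def modulus_scaleC)
qed

end

lemma norm_scaleC: "norm (c *\<^sub>C z) = cmod c * norm z"
  for z :: "'a::real_banach_lattice complexification"
  by (simp add: norm_complexification_def modulus_scaleC)

lemma norm_parts_le: "norm (re_part z) \<le> norm z" "norm (im_part z) \<le> norm z"
  for z :: "'a::real_banach_lattice complexification"
  unfolding norm_complexification_def
  by (rule lattice_norm_mono, simp add: abs_parts_le_modulus)+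

lemma norm_le_parts: "norm z \<le> norm (re_part z) + norm (im_part z)"
  for z :: "'a::real_banach_lattice complexification"
  unfolding norm_complexification_def
  using order_trans[OF norm_mono_nonneg[OF modulus_nonneg modulus_le[of z]] norm_triangle_ineq]
  by simp

instance complexification :: (real_banach_lattice) banach
proof
  fix X :: "nat \<Rightarrow> 'a complexification"
  assume X: "Cauchy X"
  have part: "Cauchy (\<lambda>n. g (X n))"
    if g: "\<And>z w. norm (g z - g w) \<le> norm (z - w)" for g :: "'a complexification \<Rightarrow> 'a"
  proof (rule metric_CauchyI)
    fix d :: real assume "0 < d"
    with X obtain N where N: "\<And>m n. N \<le> m \<Longrightarrow> N \<le> n \<Longrightarrow> dist (X m) (X n) < d"
      unfolding Cauchy_def by blast
    have "dist (g (X m)) (g (X n)) < d" if "N \<le> m" "N \<le> n" for m n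
      using le_less_trans[OF g[of "X m" "X n"]] N[OF that] by (simp add: dist_norm)
    then show "\<exists>N. \<forall>m\<ge>N. \<forall>n\<ge>N. dist (g (X m)) (g (X n)) < d" by blast
  qed
  have "Cauchy (\<lambda>n. re_part (X n))"
    by (rule part) (use norm_parts_le(1) in \<open>simp flip: parts_simps(5)\<close>)
  moreover have "Cauchy (\<lambda>n. im_part (X n))"
    by (rule part) (use norm_parts_le(2) in \<open>simp flip: parts_simps(6)\<close>)
  ultimately obtain x y where "(\<lambda>n. re_part (X n)) \<longlonglongrightarrow> x" "(\<lambda>n. im_part (X n)) \<longlonglongrightarrow> y"
    by (auto simp: Cauchy_convergent_iff convergent_def)
  then have "(\<lambda>n. norm (re_part (X n) - x) + norm (im_part (X n) - y)) \<longlonglongrightarrow> 0"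
    by (intro tendsto_add_zero) (simp_all add: LIM_zero_iff tendsto_norm_zero)
  moreover have "norm (X n - Cx x y) \<le> norm (re_part (X n) - x) + norm (im_part (X n) - y)" for n
    using norm_le_parts[of "X n - Cx x y"] by simp
  ultimately have "(\<lambda>n. X n - Cx x y) \<longlonglongrightarrow> 0"
    by (rule Lim_null_comparison[OF always_eventually[OF allI], rotated])
  then show "convergent X" by (auto simp: LIM_zero_iff convergent_def)
qed


section \<open>Linear operators on a complex Banach lattice\<close>

abbreviation clinear ::
    "('a::real_vector complexification \<Rightarrow> 'a complexification) \<Rightarrow> bool"
  where "clinear \<equiv> Vector_Spaces.linear scaleC scaleC"

definition bounded_clinear ::
    "('a::real_banach_lattice complexification \<Rightarrow> 'a complexification) \<Rightarrow> bool"
  where "bounded_clinear S \<longleftrightarrow> clinear S \<and> (\<exists>K. \<forall>f. norm (S f) \<le> K * norm f)"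

definition positive_cone :: "'a::real_banach_lattice complexification set"
  where "positive_cone = {Cx x 0 |x. 0 \<le> x}"

definition positive_operator ::
    "('a::real_banach_lattice complexification \<Rightarrow> 'a complexification) \<Rightarrow> bool"
  where "positive_operator S \<longleftrightarrow> clinear S \<and> S ` positive_cone \<subseteq> positive_cone"

text \<open>An unbounded operator is a pair of its domain and a total function, of which only the
  values on the domain are relevant.\<close>

type_synonym 'a unbounded_op =
  "'a complexification set \<times> ('a complexification \<Rightarrow> 'a complexification)"

definition shift_op :: "'a::real_vector unbounded_op \<Rightarrow> complex \<Rightarrow> 'a unbounded_op"
  where "shift_op A \<mu> = (fst A, \<lambda>f. snd A f - \<mu> *\<^sub>C f)"

definition linear_op :: "'a::real_vector unbounded_op \<Rightarrow> bool"
  where "linear_op A \<longleftrightarrow> csubspace (fst A) \<and>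
    (\<forall>f\<in>fst A. \<forall>g\<in>fst A. snd A (f + g) = snd A f + snd A g) \<and>
    (\<forall>c. \<forall>f\<in>fst A. snd A (c *\<^sub>C f) = c *\<^sub>C snd A f)"

definition closed_op :: "'a::real_banach_lattice unbounded_op \<Rightarrow> bool"
  where "closed_op A \<longleftrightarrow> closed ((\<lambda>f. (f, snd A f)) ` fst A)"

definition densely_defined :: "'a::real_banach_lattice unbounded_op \<Rightarrow> bool"
  where "densely_defined A \<longleftrightarrow> closure (fst A) = UNIV"

text \<open>The spectrum: \<open>\<mu>\<close> is a resolvent point iff \<open>A - \<mu>I\<close> maps the domain bijectively onto the
  space with bounded inverse \<open>R\<close>.\<close>

definition resolvent_set :: "'a::real_banach_lattice unbounded_op \<Rightarrow> complex set"
  where "resolvent_set A = {\<mu>. \<exists>R. bounded_clinear R \<and>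
    (\<forall>g. R g \<in> fst A \<and> snd (shift_op A \<mu>) (R g) = g) \<and>
    (\<forall>f\<in>fst A. R (snd (shift_op A \<mu>) f) = f)}"

definition spectrum :: "'a::real_banach_lattice unbounded_op \<Rightarrow> complex set"
  where "spectrum A = - resolvent_set A"

text \<open>The suprema are taken in the extended reals, where \<open>Sup {} = -\<infinity>\<close>.\<close>

definition spectral_bound :: "'a::real_banach_lattice unbounded_op \<Rightarrow> ereal"
  where "spectral_bound A = (SUP \<mu>\<in>spectrum A. ereal (Re \<mu>))"

text \<open>A set \<open>M\<close> (a subspace) has finite codimension iff finitely many classes span the quotient
  by \<open>M\<close>, i.e. iff \<open>M\<close> together with finitely many vectors spans the whole space.\<close>

definition finite_dimensional :: "'a::real_vector complexification set \<Rightarrow> bool"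
  where "finite_dimensional M \<longleftrightarrow> (\<exists>B. finite B \<and> cspan B = M)"

definition finite_codimensional :: "'a::real_vector complexification set \<Rightarrow> bool"
  where "finite_codimensional M \<longleftrightarrow> (\<exists>B. finite B \<and> cspan (M \<union> B) = UNIV)"

definition fredholm :: "'a::real_banach_lattice unbounded_op \<Rightarrow> bool"
  where "fredholm A \<longleftrightarrow> linear_op A \<and> closed_op A \<and> densely_defined A \<and>
    finite_dimensional {f \<in> fst A. snd A f = 0} \<and>
    finite_codimensional (snd A ` fst A)"

definition essential_spectrum :: "'a::real_banach_lattice unbounded_op \<Rightarrow> complex set"
  where "essential_spectrum A = {\<mu>. \<not> fredholm (shift_op A \<mu>)}"

definition essential_spectral_bound :: "'a::real_banach_lattice unbounded_op \<Rightarrow> ereal"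
  where "essential_spectral_bound A = (SUP \<mu>\<in>essential_spectrum A. ereal (Re \<mu>))"


section \<open>Semigroups\<close>

text \<open>Only the operators \<open>T t\<close> with \<open>t \<ge> 0\<close> are relevant; values at negative \<open>t\<close> are arbitrary.\<close>

definition C0_semigroup ::
    "(real \<Rightarrow> 'a::real_banach_lattice complexification \<Rightarrow> 'a complexification) \<Rightarrow> bool"
  where "C0_semigroup T \<longleftrightarrow>
    (\<forall>t\<ge>0. bounded_clinear (T t)) \<and>
    T 0 = id \<and>
    (\<forall>s\<ge>0. \<forall>t\<ge>0. T (s + t) = T s \<circ> T t) \<and>
    (\<forall>f. ((\<lambda>t. T t f) \<longlongrightarrow> f) (at_right 0))"

definition generator ::
    "(real \<Rightarrow> 'a::real_banach_lattice complexification \<Rightarrow> 'a complexification)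
      \<Rightarrow> 'a unbounded_op"
  where "generator T =
    ({f. \<exists>g. ((\<lambda>h. (T h f - f) /\<^sub>R h) \<longlongrightarrow> g) (at_right 0)},
     \<lambda>f. Lim (at_right 0) (\<lambda>h. (T h f - f) /\<^sub>R h))"

definition LEP ::
    "(real \<Rightarrow> 'a::real_banach_lattice complexification \<Rightarrow> 'a complexification)
      \<Rightarrow> (nat \<Rightarrow> 'a complexification \<Rightarrow> 'a complexification) \<Rightarrow> bool"
  where "LEP T P \<longleftrightarrow>
    (\<forall>n. \<forall>f \<in> positive_cone - {0}. \<exists>\<tau>>0. \<forall>t\<ge>\<tau>. P n (T t f) \<in> positive_cone)"

end

(*
  Let g be an eigenvector of A for l, decompose g = a - b + i(c - d) with positive a, b, c, d and
  put h = a + b + c + d. By the LEP property P_n e^(tA) h dominates the modulus of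
  P_n e^(tA) g, that is, exp(t Re l) |P_n g|, for large t. Taking Laplace transforms, P_n (m - A)^-1
  applied to a translate of h is at least |P_n g| / (m - Re l) for large real m. The Neumann series
  of the resolvent has positive coefficients when moving to the left along the real axis, so the
  estimate persists for all m > Re l as long as [Re l, oo) lies in the resolvent set. Then it
  contradicts boundedness of the resolvent near Re l. Hence [Re l, oo) meets the spectrum for every
  eigenvalue l.

  Eigenvalues l with Re l arbitrarily close to s(A) exist: starting at any spectral point to the right
  of the essential spectrum, move horizontally to the last spectral point l. There A - l is Fredholm;
  if it were injective, it would be bounded below, hence the resolvent would stay bounded near l and
  l could not be a spectral point. As the spectrum is closed, s(A) belongs to it.
*)
theory Submission
  imports Defs
begin

section \<open>Banach space preliminaries\<close>

text \<open>The obstacle is that P_n need not commute with the semigroup or with the resolvent, so a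
  lower bound for P_n at a single vector cannot be iterated through a Neumann series. The remedy is
  to work with the sets \<open>C r\<close> of all x whose entire forward orbit satisfies Q (T s x)
  >= r v, where Q = P_n. These sets are stable under T, hence under Laplace integrals, hence under
  Neumann series. Rescaling by Re l makes the eigenvalue imaginary, so v = |P_n g| does not depend
  on time. The resolvent at m > 0 then maps \<open>C r\<close> into \<open>C (r / m)\<close>,
  because exp(-m t) has integral 1/m. Each Neumann step to the left reproduces this factor exactly,
  so no loss accumulates however many steps are made. As m tends to 0, m times the resolvent applied
  to one fixed vector stays in \<open>C 1\<close> and tends to 0 in norm. Since \<open>C 1\<close>
  is closed, this gives 0 >= v and hence P_n g = 0. The waiting time in the LEP property depends on
  the vector, but only a, b, c, d enter, so one time serves for all of them.\<close>

lemma Baire_symmetric: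
  fixes F :: "nat \<Rightarrow> 'b::banach set"
  assumes closed: "\<And>n. closed (F n)" and cover: "\<And>x. \<exists>n. x \<in> F n"
    and half: "\<And>n x y. x \<in> F n \<Longrightarrow> y \<in> F n \<Longrightarrow> (1/2) *\<^sub>R (x - y) \<in> F n"
  shows "\<exists>n. \<exists>r>0. ball 0 r \<subseteq> F n"
proof -
  have "\<exists>n. interior (F n) \<noteq> {}"
  proof (rule ccontr)
    assume "\<nexists>n. interior (F n) \<noteq> {}"
    then have "interior (\<Union>(range F)) = {}"
      using Met_TC.metric_Baire_category_alt[of "range F"] closed
      by (auto simp: complete_UNIV)
    moreover have "\<Union>(range F) = UNIV" using cover by blast
    ultimately show False by simp
  qed
  then obtain n x r where r: "r > 0" "ball x r \<subseteq> F n"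
    by (metis all_not_in_conv mem_interior)
  \<comment> \<open>Baire yields a ball around some x only; stability under half differences
    recentres it at the origin with the same \<open>n\<close> and \<open>r\<close>.\<close>
  have "y \<in> F n" if "y \<in> ball 0 r" for y
  proof -
    have "x + y \<in> F n" "x - y \<in> F n" using r that by (auto simp: dist_norm subset_iff)
    from half[OF this] show ?thesis by (simp add: scaleR_2[symmetric])
  qed
  then show ?thesis using r by blast
qed

lemma uniform_boundedness:
  fixes F :: "nat \<Rightarrow> 'b::banach \<Rightarrow> 'c::real_normed_vector"
  assumes lin: "\<And>n. bounded_linear (F n)" and bd: "\<And>x. \<exists>B. \<forall>n. norm (F n x) \<le> B"
  obtains K where "\<And>n x. norm (F n x) \<le> K * norm x"
proof -
  define G where "G m = {x. \<forall>n. norm (F n x) \<le> real m}" for m :: nat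
  have "\<exists>m. \<exists>r>0. ball 0 r \<subseteq> G m"
  proof (rule Baire_symmetric)
    fix m
    have "G m = (\<Inter>n. {x. norm (F n x) \<le> real m})" by (auto simp: G_def)
    moreover have "closed {x. norm (F n x) \<le> real m}" for n
      by (intro closed_Collect_le continuous_intros linear_continuous_on lin)
    ultimately show "closed (G m)" by auto
  next
    fix x
    obtain B where "\<forall>n. norm (F n x) \<le> B" using bd by blast
    moreover obtain m :: nat where "B \<le> real m" using real_arch_simple by blast
    ultimately have "x \<in> G m" unfolding G_def using order_trans by blast
    then show "\<exists>m. x \<in> G m" ..
  next
    fix m x y assume xy: "x \<in> G m" "y \<in> G m"
    have "norm (F n ((1/2) *\<^sub>R (x - y))) \<le> real m" for n
    proof -
      interpret bounded_linear "F n" by (rule lin)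
      have "norm (F n x) \<le> real m" "norm (F n y) \<le> real m" using xy by (auto simp: G_def)
      then show ?thesis using norm_triangle_ineq4[of "F n x" "F n y"] by (simp add: scaleR diff)
    qed
    then show "(1/2) *\<^sub>R (x - y) \<in> G m" by (simp add: G_def)
  qed
  then obtain m r where r: "r > 0" "ball 0 r \<subseteq> G m" by blast
  \<comment> \<open>Scaled to norm r / 2, every nonzero x enters the ball on which all
    \<open>F n\<close> are bounded by m.\<close>
  have "norm (F n x) \<le> (2 * real m / r) * norm x" for n x
  proof (cases "x = 0")
    case False
    interpret bounded_linear "F n" by (rule lin)
    define c where "c = r / (2 * norm x)"
    have c: "c > 0" using False r by (simp add: c_def)
    have "norm (c *\<^sub>R x) = r / 2" using False r by (simp add: c_def)
    then have "c *\<^sub>R x \<in> G m" using r by (auto simp: subset_iff)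
    then have "norm (F n (c *\<^sub>R x)) \<le> real m" by (auto simp: G_def)
    then have "c * norm (F n x) \<le> real m" using c by (simp add: scaleR)
    then show ?thesis using False r by (simp add: c_def field_simps)
  qed (simp add: linear_simps(3)[OF lin])
  then show ?thesis by (rule that)
qed

text \<open>The open mapping theorem in terms of the image \<open>K\<close> of the unit ball, which makes it
  applicable to maps defined on products with finite-dimensional spaces of any dimension.\<close>

lemma open_mapping_unit_ball_image:
  fixes K :: "'b::banach set"
  assumes half: "\<And>x y. x \<in> K \<Longrightarrow> y \<in> K \<Longrightarrow> (1/2) *\<^sub>R (x - y) \<in> K"
    and absorb: "\<And>x. \<exists>n. \<exists>k\<in>K. x = real (Suc n) *\<^sub>R k"
    and sigma: "\<And>k y. (\<And>i. k i \<in> K) \<Longrightarrow> (\<lambda>i. (1/2) ^ Suc i *\<^sub>R k i) sums y \<Longrightarrow> y \<in> K"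
  shows "\<exists>d>0. ball 0 d \<subseteq> K"
proof -
  have half_cl: "(1/2) *\<^sub>R (x - y) \<in> closure K" if xy: "x \<in> closure K" "y \<in> closure K" for x y
  proof -
    obtain X Y where X: "\<And>n. X n \<in> K" "X \<longlonglongrightarrow> x" and Y: "\<And>n. Y n \<in> K" "Y \<longlonglongrightarrow> y"
      using xy unfolding closure_sequential by blast
    have "(\<lambda>n. (1/2) *\<^sub>R (X n - Y n)) \<longlonglongrightarrow> (1/2) *\<^sub>R (x - y)"
      by (intro tendsto_intros X Y)
    moreover have "(1/2) *\<^sub>R (X n - Y n) \<in> K" for n by (intro half X Y)
    ultimately show ?thesis
      unfolding closure_sequential by (intro exI[of _ "\<lambda>n. (1/2) *\<^sub>R (X n - Y n)"]) simp
  qed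
  have "\<exists>n. \<exists>r>0. ball 0 r \<subseteq> (\<lambda>x. real (Suc n) *\<^sub>R x) ` closure K"
  proof (rule Baire_symmetric)
    show "closed ((\<lambda>x. real (Suc n) *\<^sub>R x) ` closure K)" for n
      by (intro closed_scaling closed_closure)
    show "\<exists>n. x \<in> (\<lambda>x. real (Suc n) *\<^sub>R x) ` closure K" for x
      using absorb[of x] closure_subset by blast
    show "(1/2) *\<^sub>R (x - y) \<in> (\<lambda>x. real (Suc n) *\<^sub>R x) ` closure K"
      if xy: "x \<in> (\<lambda>x. real (Suc n) *\<^sub>R x) ` closure K" "y \<in> (\<lambda>x. real (Suc n) *\<^sub>R x) ` closure K"
      for n x y
    proof -
      obtain u v where uv: "u \<in> closure K" "v \<in> closure K"
        "x = real (Suc n) *\<^sub>R u" "y = real (Suc n) *\<^sub>R v" using xy by blast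
      then have "(1/2) *\<^sub>R (x - y) = real (Suc n) *\<^sub>R ((1/2) *\<^sub>R (u - v))"
        by (simp only: scaleR_diff_right scaleR_scaleR mult.commute)
      then show ?thesis using half_cl uv by blast
    qed
  qed
  then obtain n r where r: "r > 0" "ball 0 r \<subseteq> (\<lambda>x. real (Suc n) *\<^sub>R x) ` closure K" by blast
  define e where "e = r / real (Suc n)"
  have e: "e > 0" using r by (simp add: e_def)
  have ecl: "z \<in> closure K" if "norm z < e" for z
  proof -
    have "norm (real (Suc n) *\<^sub>R z) < r" using that by (simp add: e_def pos_less_divide_eq mult.commute del: of_nat_Suc)
    then have "real (Suc n) *\<^sub>R z \<in> (\<lambda>x. real (Suc n) *\<^sub>R x) ` closure K" using r by auto
    then show ?thesis by (auto simp del: of_nat_Suc)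
  qed
  have "\<exists>k. k \<in> K \<and> norm (z - k) < e / 2" if "norm z < e" for z
    using ecl[OF that] e unfolding closure_approachable
    by (metis dist_commute dist_norm half_gt_zero)
  then obtain g where g: "\<And>z. norm z < e \<Longrightarrow> g z \<in> K \<and> norm (z - g z) < e / 2" by metis
  have "y \<in> K" if "norm y < e / 2" for y
  proof -
    \<comment> \<open>Successive approximation: \<open>Y i\<close> is the remainder after
      \<open>i\<close> terms, blown up by 2^(i+1). One approximation brings the norm below e / 2 and
      doubling brings it back below e, so the process never leaves the domain of
      \<open>g\<close>.\<close>
    define Y where "Y = rec_nat (2 *\<^sub>R y) (\<lambda>_ z. 2 *\<^sub>R (z - g z))"
    have Y0: "Y 0 = 2 *\<^sub>R y" and YS: "\<And>i. Y (Suc i) = 2 *\<^sub>R (Y i - g (Y i))"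
      by (simp_all add: Y_def)
    have Ye: "norm (Y i) < e" for i
    proof (induction i)
      case 0 then show ?case using that by (simp add: Y0)
    next
      case (Suc i) then show ?case using g[of "Y i"] by (simp add: YS)
    qed
    have part: "(\<Sum>i<n. (1/2) ^ Suc i *\<^sub>R g (Y i)) = y - (1/2) ^ Suc n *\<^sub>R Y n" for n
      by (induction n) (simp_all add: Y0 YS algebra_simps)
    have "(\<lambda>n. (1/2::real) ^ Suc n * e) \<longlonglongrightarrow> 0"
      by (intro tendsto_mult_left_zero LIMSEQ_Suc LIMSEQ_power_zero) auto
    moreover have "norm ((1/2) ^ Suc n *\<^sub>R Y n) \<le> (1/2) ^ Suc n * e" for n
      using Ye[of n] by (simp add: norm_power less_imp_le)
    ultimately have "(\<lambda>n. (1/2) ^ Suc n *\<^sub>R Y n) \<longlonglongrightarrow> 0"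
      by (rule Lim_null_comparison[OF always_eventually[OF allI], rotated])
    then have "(\<lambda>n. y - (1/2) ^ Suc n *\<^sub>R Y n) \<longlonglongrightarrow> y - 0" by (intro tendsto_intros)
    then have "(\<lambda>i. (1/2) ^ Suc i *\<^sub>R g (Y i)) sums y"
      unfolding sums_def part by (simp only: diff_0_right)
    then show ?thesis by (rule sigma[rotated]) (use g Ye in blast)
  qed
  then show ?thesis using e by (intro exI[of _ "e / 2"]) auto
qed

section \<open>Neumann series of strict contractions\<close>

definition neumann :: "('b::real_normed_vector \<Rightarrow> 'b) \<Rightarrow> 'b \<Rightarrow> 'b"
  where "neumann U x = (\<Sum>k. (U ^^ k) x)"

locale strict_contraction =
  bounded_linear U for U :: "'b::banach \<Rightarrow> 'b" +
  fixes q :: real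
  assumes q1: "q < 1" and q0: "0 \<le> q" and contr: "norm (U x) \<le> q * norm x"
begin

lemma norm_funpow: "norm ((U ^^ k) x) \<le> q ^ k * norm x"
proof (induction k)
  case (Suc k)
  have "norm ((U ^^ Suc k) x) \<le> q * norm ((U ^^ k) x)" using contr by simp
  also have "\<dots> \<le> q * (q ^ k * norm x)" by (intro mult_left_mono Suc q0)
  finally show ?case by (simp add: mult_ac)
qed simp

lemma norm_geometric_sums: "(\<lambda>k. q ^ k * norm x) sums (norm x / (1 - q))"
  using sums_mult2[OF geometric_sums[of q], of "norm x"] q0 q1 by simp

lemma neumann_sums: "(\<lambda>k. (U ^^ k) x) sums neumann U x"
  unfolding neumann_def
  by (intro summable_sums summable_comparison_test'[OF sums_summable[OF norm_geometric_sums[of x]]])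
     (rule norm_funpow)

lemma norm_neumann: "norm (neumann U x) \<le> norm x / (1 - q)"
  unfolding neumann_def sums_unique[OF norm_geometric_sums[of x]]
  by (intro norm_suminf_le norm_funpow sums_summable[OF norm_geometric_sums])

text \<open>Continuity of \<open>L\<close> carries it through the series term by term. Taking
  \<open>L\<close> to be a scalar multiplication gives homogeneity of the series, and
  \<open>L = U\<close> turns the right inverse into a left inverse.\<close>

lemma neumann_commute:
  assumes "bounded_linear L" "\<And>x. L (U x) = U (L x)"
  shows "L (neumann U x) = neumann U (L x)"
proof -
  have "L ((U ^^ k) x) = (U ^^ k) (L x)" for k by (induction k) (simp_all add: assms)
  then have "(\<lambda>k. (U ^^ k) (L x)) sums L (neumann U x)"
    using bounded_linear.sums[OF assms(1) neumann_sums[of x]] by simp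
  then show ?thesis using neumann_sums sums_unique2 by blast
qed

lemma neumann_right: "neumann U x - U (neumann U x) = x"
proof -
  have "(\<lambda>k. (U ^^ Suc k) x) sums U (neumann U x)"
    using sums[OF neumann_sums[of x]] by simp
  moreover have "(\<lambda>k. (U ^^ Suc k) x) sums (neumann U x - x)"
    using neumann_sums[of x] by (subst sums_Suc_iff) simp
  ultimately have "U (neumann U x) = neumann U x - x" by (rule sums_unique2)
  then show ?thesis by simp
qed

lemma bounded_linear_neumann: "bounded_linear (neumann U)"
proof (rule bounded_linear_intro)
  have pow: "(U ^^ k) (x + y) = (U ^^ k) x + (U ^^ k) y" for k x y
    by (induction k) (simp_all add: add)
  show "neumann U (x + y) = neumann U x + neumann U y" for x y
    using sums_unique2[OF neumann_sums[of "x + y"]] sums_add[OF neumann_sums[of x] neumann_sums[of y]]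
    by (simp add: pow)
  show "neumann U (r *\<^sub>R x) = r *\<^sub>R neumann U x" for r x
    using neumann_commute[OF bounded_linear_scaleR_right, of r] by (simp add: scaleR)
  show "norm (neumann U x) \<le> norm x * (1 / (1 - q))" for x
    using norm_neumann by simp
qed

lemma neumann_left: "neumann U (x - U x) = x"
  using neumann_right[of x] neumann_commute[OF bounded_linear_axioms, of x]
  by (simp add: linear_diff[OF bounded_linear.linear[OF bounded_linear_neumann]])

end

text \<open>Riemann sums over tagged divisions are combinations of values of \<open>f\<close> with
  nonnegative weights, hence lie in the convex cone \<open>K\<close>; the integral is a limit of
  them and \<open>K\<close> is closed.\<close>

lemma has_integral_in_cone:
  fixes f :: "real \<Rightarrow> 'b::real_normed_vector"
  assumes I: "(f has_integral I) {a..b}" and cl: "closed K" and f: "\<And>t. t \<in> {a..b} \<Longrightarrow> f t \<in> K"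
    and zero: "0 \<in> K" and add: "\<And>x y. x \<in> K \<Longrightarrow> y \<in> K \<Longrightarrow> x + y \<in> K"
    and scale: "\<And>c x. 0 \<le> c \<Longrightarrow> x \<in> K \<Longrightarrow> c *\<^sub>R x \<in> K"
  shows "I \<in> K"
proof -
  have "\<exists>y\<in>K. dist y I < e" if "e > 0" for e
  proof -
    obtain g where g: "gauge g" "\<And>D. D tagged_division_of {a..b} \<Longrightarrow> g fine D \<Longrightarrow>
        norm ((\<Sum>(x, k)\<in>D. measure lborel k *\<^sub>R f x) - I) < e"
      using I \<open>e > 0\<close> unfolding has_integral_real by meson
    obtain D where D: "D tagged_division_of {a..b}" "g fine D"
      using fine_division_exists_real[OF g(1)] .
    have "(\<Sum>p\<in>S. measure lborel (snd p) *\<^sub>R f (fst p)) \<in> K" if "finite S" "S \<subseteq> D" for S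
      using that
    proof (induction S rule: finite_induct)
      case (insert p S)
      have "fst p \<in> {a..b}" using insert D(1) by (cases p) (auto dest!: tag_in_interval)
      then show ?case using insert by (auto intro!: add scale f)
    qed (simp add: zero)
    moreover have "finite D" using D(1) by (rule tagged_division_of_finite)
    ultimately have "(\<Sum>(x, k)\<in>D. measure lborel k *\<^sub>R f x) \<in> K" by (simp add: case_prod_beta)
    then show ?thesis using g(2)[OF D] by (auto simp: dist_norm)
  qed
  then have "I \<in> closure K" by (simp add: closure_approachable)
  then show ?thesis using cl by simp
qed

section \<open>Resolvents and Fredholm operators\<close>

lemma clinear_iff:
  "clinear S \<longleftrightarrow> (\<forall>x y. S (x + y) = S x + S y) \<and> (\<forall>c x. S (c *\<^sub>C x) = c *\<^sub>C S x)"
  by (simp add: Vector_Spaces.linear_iff complexification.vector_space_axioms)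

lemma bounded_clinear_iff:
  "bounded_clinear S \<longleftrightarrow> bounded_linear S \<and> (\<forall>c x. S (c *\<^sub>C x) = c *\<^sub>C S x)"
proof
  assume S: "bounded_clinear S"
  then obtain K where K: "\<And>f. norm (S f) \<le> K * norm f" and lin: "clinear S"
    unfolding bounded_clinear_def by blast
  have "bounded_linear S"
    by (rule bounded_linear_intro[of _ K])
       (use K lin in \<open>simp_all add: clinear_iff scaleR_complexification_def mult.commute\<close>)
  then show "bounded_linear S \<and> (\<forall>c x. S (c *\<^sub>C x) = c *\<^sub>C S x)"
    using lin by (simp add: clinear_iff)
next
  assume S: "bounded_linear S \<and> (\<forall>c x. S (c *\<^sub>C x) = c *\<^sub>C S x)"
  then interpret bounded_linear S by simp
  show "bounded_clinear S"
    unfolding bounded_clinear_def clinear_iff using S add bounded by (auto simp: mult.commute)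
qed

lemma bounded_clinear_bounded_linear: "bounded_clinear S \<Longrightarrow> bounded_linear S"
  by (simp add: bounded_clinear_iff)

lemma bounded_clinear_scaleC: "bounded_clinear S \<Longrightarrow> S (c *\<^sub>C x) = c *\<^sub>C S x"
  by (simp add: bounded_clinear_iff)

lemma bounded_bilinear_scaleC:
  "bounded_bilinear (scaleC :: complex \<Rightarrow> 'a::real_banach_lattice complexification \<Rightarrow> _)"
  by standard
     (auto simp: complexification_eq_iff algebra_simps norm_scaleC intro!: exI[of _ 1])

lemmas bounded_linear_scaleC_right = bounded_bilinear.bounded_linear_right[OF bounded_bilinear_scaleC]
lemmas tendsto_scaleC = bounded_bilinear.tendsto[OF bounded_bilinear_scaleC]

text \<open>Names the witness that \<open>resolvent_set\<close> hides under a quantifier. The sign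
  is that of the inverse of A - \<mu>, so it is - R that inherits positivity from the Laplace
  integral.\<close>

definition resolvent_at ::
    "'a::real_banach_lattice unbounded_op \<Rightarrow> complex \<Rightarrow> ('a complexification \<Rightarrow> 'a complexification) \<Rightarrow> bool"
  where "resolvent_at A \<mu> R \<longleftrightarrow> bounded_clinear R \<and>
    (\<forall>g. R g \<in> fst A \<and> snd A (R g) - \<mu> *\<^sub>C R g = g) \<and>
    (\<forall>f\<in>fst A. R (snd A f - \<mu> *\<^sub>C f) = f)"

lemma resolvent_set_iff: "\<mu> \<in> resolvent_set A \<longleftrightarrow> (\<exists>R. resolvent_at A \<mu> R)"
  by (simp add: resolvent_set_def resolvent_at_def shift_op_def)

text \<open>Norm bounds and cone bounds are proved for resolvents obtained in different ways;
  uniqueness makes them speak of the same operator.\<close>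

lemma resolvent_at_unique:
  assumes "resolvent_at A \<mu> R" "resolvent_at A \<mu> S"
  shows "R = S"
proof
  fix x
  have S: "S x \<in> fst A" "snd A (S x) - \<mu> *\<^sub>C S x = x" using assms(2) by (auto simp: resolvent_at_def)
  have "R (snd A (S x) - \<mu> *\<^sub>C S x) = S x" using assms(1) S(1) by (simp add: resolvent_at_def)
  then show "R x = S x" by (simp only: S(2))
qed

lemma resolvent_at_bound:
  assumes "resolvent_at A \<mu> R"
  obtains K where "K > 0" "\<And>x. norm (R x) \<le> K * norm x"
  using assms bounded_linear.pos_bounded[OF bounded_clinear_bounded_linear]
  by (metis mult.commute resolvent_at_def)

lemma bounded_clinear_neumann:
  assumes "strict_contraction U q" "\<And>c x. U (c *\<^sub>C x) = c *\<^sub>C U x"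
  shows "bounded_clinear (neumann U)"
proof -
  interpret strict_contraction U q by fact
  show ?thesis
    using bounded_linear_neumann neumann_commute[OF bounded_linear_scaleC_right] assms(2)
    by (simp add: bounded_clinear_iff)
qed

text \<open>On the domain, A - l factors as (I - U)(A - \<mu>) with U = (l - \<mu>) R, so its
  inverse is R followed after the Neumann series of U. The contraction constant 1/2 makes the norm
  bound at most double.\<close>

lemma resolvent_perturb:
  assumes R: "resolvent_at A \<mu> R" and K: "\<And>x. norm (R x) \<le> K * norm x" and K0: "0 < K"
    and small: "cmod (l - \<mu>) * K \<le> 1 / 2"
  shows "strict_contraction (\<lambda>x. (l - \<mu>) *\<^sub>C R x) (1/2)"
    and "resolvent_at A l (\<lambda>x. R (neumann (\<lambda>x. (l - \<mu>) *\<^sub>C R x) x))"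
    and "norm (R (neumann (\<lambda>x. (l - \<mu>) *\<^sub>C R x) x)) \<le> 2 * K * norm x"
proof -
  let ?U = "\<lambda>x. (l - \<mu>) *\<^sub>C R x"
  have Rc: "bounded_clinear R" and RR: "\<And>g. R g \<in> fst A" "\<And>g. snd A (R g) - \<mu> *\<^sub>C R g = g"
    and RL: "\<And>f. f \<in> fst A \<Longrightarrow> R (snd A f - \<mu> *\<^sub>C f) = f"
    using R by (auto simp: resolvent_at_def)
  interpret R: bounded_linear R using Rc by (rule bounded_clinear_bounded_linear)
  have Rs: "R (c *\<^sub>C x) = c *\<^sub>C R x" for c x using Rc by (rule bounded_clinear_scaleC)
  show sc: "strict_contraction ?U (1/2)"
  proof (intro strict_contraction.intro strict_contraction_axioms.intro)
    show "bounded_linear ?U"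
      by (rule bounded_linear_compose[OF bounded_linear_scaleC_right R.bounded_linear_axioms])
    show "norm (?U x) \<le> 1 / 2 * norm x" for x
    proof -
      have "norm (?U x) \<le> cmod (l - \<mu>) * (K * norm x)"
        unfolding norm_scaleC by (intro mult_left_mono K) simp
      also have "\<dots> = cmod (l - \<mu>) * K * norm x" by simp
      also have "\<dots> \<le> 1 / 2 * norm x" by (intro mult_right_mono small) simp
      finally show ?thesis .
    qed
  qed auto
  interpret N: strict_contraction ?U "1/2" by (rule sc)
  have Nc: "bounded_clinear (neumann ?U)"
    by (rule bounded_clinear_neumann[OF sc]) (simp add: Rs mult.commute)
  have comm: "R (neumann ?U x) = neumann ?U (R x)" for x
    by (rule N.neumann_commute[OF R.bounded_linear_axioms]) (simp add: Rs)
  have "bounded_clinear (\<lambda>x. R (neumann ?U x))"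
    using Nc Rc bounded_linear_compose[of R "neumann ?U"] by (simp add: bounded_clinear_iff)
  moreover have "snd A (R (neumann ?U g)) - l *\<^sub>C R (neumann ?U g) = g" for g
  proof -
    have "snd A (R (neumann ?U g)) - l *\<^sub>C R (neumann ?U g)
      = (snd A (R (neumann ?U g)) - \<mu> *\<^sub>C R (neumann ?U g)) - ?U (neumann ?U g)"
      by (simp add: complexification.scale_left_diff_distrib)
    also have "\<dots> = g" unfolding RR(2) by (rule N.neumann_right)
    finally show ?thesis .
  qed
  moreover have "R (neumann ?U (snd A f - l *\<^sub>C f)) = f" if f: "f \<in> fst A" for f
  proof -
    have "snd A f - l *\<^sub>C f = (snd A f - \<mu> *\<^sub>C f) - (l - \<mu>) *\<^sub>C f"
      by (simp add: complexification.scale_left_diff_distrib)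
    then have "R (snd A f - l *\<^sub>C f) = f - ?U f" using RL[OF f] by (simp only: R.diff Rs)
    then show ?thesis unfolding comm by (simp only: N.neumann_left)
  qed
  ultimately show "resolvent_at A l (\<lambda>x. R (neumann ?U x))"
    using RR(1) by (simp add: resolvent_at_def)
  have "norm (R (neumann ?U x)) \<le> K * norm (neumann ?U x)" by (rule K)
  also have "\<dots> \<le> K * (2 * norm x)" using N.norm_neumann[of x] K0 by (intro mult_left_mono) auto
  finally show "norm (R (neumann ?U x)) \<le> 2 * K * norm x" by (simp add: mult_ac)
qed

lemma resolvent_set_ball:
  assumes R: "resolvent_at A \<mu> R" and K: "\<And>x. norm (R x) \<le> K * norm x" "K > 0"
    and small: "cmod (l - \<mu>) \<le> 1 / (2 * K)"
  shows "l \<in> resolvent_set A"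
proof -
  have "cmod (l - \<mu>) * K \<le> 1 / 2" using small K(2) by (simp add: field_simps)
  then show ?thesis using resolvent_perturb(2)[OF R K] resolvent_set_iff by blast
qed

lemma closed_spectrum: "closed (spectrum A)"
proof -
  have "\<exists>d>0. ball \<mu> d \<subseteq> resolvent_set A" if "\<mu> \<in> resolvent_set A" for \<mu>
  proof -
    obtain R where R: "resolvent_at A \<mu> R" using \<open>\<mu> \<in> resolvent_set A\<close> resolvent_set_iff by blast
    obtain K where K: "K > 0" "\<And>x. norm (R x) \<le> K * norm x" using resolvent_at_bound[OF R] by blast
    have "ball \<mu> (1 / (2 * K)) \<subseteq> resolvent_set A"
      using resolvent_set_ball[OF R K(2,1)] by (auto simp: dist_norm norm_minus_commute)
    then show ?thesis using K by (intro exI[of _ "1 / (2 * K)"]) auto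
  qed
  then have "open (resolvent_set A)" by (auto simp: open_contains_ball)
  then show ?thesis by (simp add: spectrum_def closed_Compl)
qed

section \<open>Fredholm operators and boundary points of the spectrum\<close>

lemma finite_codim_independent_complement:
  assumes M: "csubspace M" and "finite_codimensional M"
  obtains B where "finite B" "\<And>y. \<exists>x\<in>M. \<exists>c. y = x + (\<Sum>b\<in>B. c b *\<^sub>C b)"
    "\<And>c. (\<Sum>b\<in>B. c b *\<^sub>C b) \<in> M \<Longrightarrow> \<forall>b\<in>B. c b = 0"
proof -
  define Q where "Q B \<longleftrightarrow> finite B \<and> cspan (M \<union> B) = UNIV" for B
  have "\<exists>B. Q B" using assms(2) by (simp add: finite_codimensional_def Q_def)
  then obtain B where B: "Q B" and min: "\<And>B'. Q B' \<Longrightarrow> card B \<le> card B'"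
    using ex_has_least_nat[of Q _ card] by blast
  have fin: "finite B" and span: "cspan (M \<union> B) = UNIV" using B by (auto simp: Q_def)
  have "\<exists>x\<in>M. \<exists>c. y = x + (\<Sum>b\<in>B. c b *\<^sub>C b)" for y
  proof -
    have "y \<in> {x + z |x z. x \<in> cspan M \<and> z \<in> cspan B}"
      using span complexification.span_Un[of M B] by auto
    moreover have "cspan M = M" using M by simp
    ultimately obtain x z where "x \<in> M" "z \<in> cspan B" "y = x + z" by blast
    moreover obtain c where "z = (\<Sum>b\<in>B. c b *\<^sub>C b)"
      using \<open>z \<in> cspan B\<close> unfolding complexification.span_finite[OF fin] by auto
    ultimately show ?thesis by blast
  qed
  moreover have "\<forall>b\<in>B. c b = 0" if c: "(\<Sum>b\<in>B. c b *\<^sub>C b) \<in> M" for c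
  proof (rule ccontr)
    assume "\<not> (\<forall>b\<in>B. c b = 0)"
    then obtain b where b: "b \<in> B" "c b \<noteq> 0" by blast
    define s where "s = (\<Sum>b\<in>B. c b *\<^sub>C b)"
    let ?V = "cspan (M \<union> (B - {b}))"
    have "s = c b *\<^sub>C b + (\<Sum>b\<in>B - {b}. c b *\<^sub>C b)"
      unfolding s_def using fin b by (simp add: sum.remove)
    then have b_eq: "b = inverse (c b) *\<^sub>C (s - (\<Sum>b\<in>B - {b}. c b *\<^sub>C b))"
      using b by simp
    have "s \<in> ?V" using c by (auto simp: s_def intro: complexification.span_base)
    moreover have "(\<Sum>b\<in>B - {b}. c b *\<^sub>C b) \<in> ?V"
      by (intro complexification.span_sum complexification.span_scale complexification.span_base) auto
    ultimately have "b \<in> ?V"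
      by (subst b_eq) (intro complexification.span_scale complexification.span_diff)
    moreover have "insert b (M \<union> (B - {b})) = M \<union> B" using b by auto
    ultimately have "?V = UNIV" using complexification.span_redundant span by metis
    then have "Q (B - {b})" using fin by (simp add: Q_def)
    then have "card B \<le> card (B - {b})" by (rule min)
    then show False using fin b by (metis card_Diff1_less not_less)
  qed
  ultimately show ?thesis using that fin by blast
qed

text \<open>Adding a complement of the range makes \<open>W\<close> a continuous bijection from a
  product with a finite-dimensional space onto the whole space. Its inverse is bounded by the open
  mapping theorem, and restricting to the range of \<open>W\<close> gives the lower bound; no
  separate proof of a closed range is made.\<close>

lemma injective_finite_codim_bounded_below:
  fixes W :: "'a::real_banach_lattice complexification \<Rightarrow> 'a complexification"
  assumes W: "bounded_clinear W" and inj: "\<And>x. W x = 0 \<Longrightarrow> x = 0"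
    and codim: "finite_codimensional (range W)"
  obtains c where "c > 0" "\<And>x. norm x \<le> c * norm (W x)"
proof -
  interpret W: bounded_linear W using W by (rule bounded_clinear_bounded_linear)
  have Ws: "W (c *\<^sub>C x) = c *\<^sub>C W x" for c x using W by (rule bounded_clinear_scaleC)
  have "csubspace (range W)"
  proof (rule complexification.subspaceI)
    show "0 \<in> range W" by (rule range_eqI[of _ _ 0]) (simp add: W.zero)
    show "x + y \<in> range W" if "x \<in> range W" "y \<in> range W" for x y
      using that by (auto simp flip: W.add)
    show "c *\<^sub>C x \<in> range W" if "x \<in> range W" for c x
      using that by (auto simp flip: Ws)
  qed
  then obtain B where fin: "finite B" and span: "\<And>y. \<exists>x\<in>range W. \<exists>c. y = x + (\<Sum>b\<in>B. c b *\<^sub>C b)"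
    and ind: "\<And>c. (\<Sum>b\<in>B. c b *\<^sub>C b) \<in> range W \<Longrightarrow> \<forall>b\<in>B. c b = 0"
    using finite_codim_independent_complement[OF _ codim] by blast
  \<comment> \<open>A coefficient vector is a function read only on \<open>B\<close>, which models
    the finite-dimensional factor for a \<open>B\<close> of any size.\<close>
  define L where "L x c = W x + (\<Sum>b\<in>B. c b *\<^sub>C b)" for x c
  define K where "K = {L x c |x c. norm x \<le> 1 \<and> (\<forall>b\<in>B. cmod (c b) \<le> 1)}"
  have KI: "L x c \<in> K" if "norm x \<le> 1" "\<And>b. b \<in> B \<Longrightarrow> cmod (c b) \<le> 1" for x c
    using that unfolding K_def by blast
  have Lscale: "L (r *\<^sub>R x) (\<lambda>b. of_real r * c b) = r *\<^sub>R L x c" for r x c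
    by (simp add: L_def W.scaleR scaleR_add_right scaleR_sum_right)
       (simp add: scaleR_complexification_def)
  have Ldiff: "L x c - L y d = L (x - y) (\<lambda>b. c b - d b)" for x y c d
    by (simp add: L_def W.diff complexification.scale_left_diff_distrib sum_subtractf)
  have "\<exists>d>0. ball 0 d \<subseteq> K"
  proof (rule open_mapping_unit_ball_image)
    fix u v assume "u \<in> K" "v \<in> K"
    then obtain x c y d where uv: "u = L x c" "v = L y d" "norm x \<le> 1" "norm y \<le> 1"
      "\<And>b. b \<in> B \<Longrightarrow> cmod (c b) \<le> 1" "\<And>b. b \<in> B \<Longrightarrow> cmod (d b) \<le> 1"
      unfolding K_def by blast
    have "(1/2) *\<^sub>R (u - v) = L ((1/2) *\<^sub>R (x - y)) (\<lambda>b. of_real (1/2) * (c b - d b))"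
      by (simp only: uv Ldiff Lscale)
    also have "\<dots> \<in> K"
    proof (rule KI)
      show "norm ((1/2) *\<^sub>R (x - y)) \<le> 1" using norm_triangle_ineq4[of x y] uv by simp
      show "cmod (of_real (1/2) * (c b - d b)) \<le> 1" if "b \<in> B" for b
        using norm_triangle_ineq4[of "c b" "d b"] uv(5,6)[OF that] unfolding norm_mult norm_of_real by simp
    qed
    finally show "(1/2) *\<^sub>R (u - v) \<in> K" .
  next
    fix y
    obtain x c where y: "y = L x c" using span[of y] by (auto simp: L_def)
    obtain n :: nat where n: "norm x + (\<Sum>b\<in>B. cmod (c b)) \<le> real n" using real_arch_simple by blast
    define r where "r = real (Suc n)"
    have r: "r > 0" by (simp add: r_def)
    have "norm x \<le> r" using n sum_nonneg[of B "\<lambda>b. cmod (c b)"] by (simp add: r_def)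
    moreover have "cmod (c b) \<le> r" if "b \<in> B" for b
    proof -
      have "cmod (c b) \<le> (\<Sum>b\<in>B. cmod (c b))" by (rule member_le_sum[OF that _ fin]) simp
      then show ?thesis using n norm_ge_zero[of x] unfolding r_def of_nat_Suc by linarith
    qed
    ultimately have "L (inverse r *\<^sub>R x) (\<lambda>b. of_real (inverse r) * c b) \<in> K"
      using r by (intro KI) (simp_all add: norm_mult norm_divide norm_inverse divide_simps)
    moreover have "y = r *\<^sub>R L (inverse r *\<^sub>R x) (\<lambda>b. of_real (inverse r) * c b)"
      unfolding Lscale y using r by simp
    ultimately show "\<exists>n. \<exists>k\<in>K. y = real (Suc n) *\<^sub>R k" unfolding r_def by blast
  next
    fix k y assume kK: "\<And>i. k i \<in> K" and sums: "(\<lambda>i. (1/2) ^ Suc i *\<^sub>R k i) sums y"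
    have "\<forall>i. \<exists>x c. k i = L x c \<and> norm x \<le> 1 \<and> (\<forall>b\<in>B. cmod (c b) \<le> 1)"
      using kK unfolding K_def by blast
    then obtain x c where k: "\<And>i. k i = L (x i) (c i)" "\<And>i. norm (x i) \<le> 1"
      "\<And>i b. b \<in> B \<Longrightarrow> cmod (c i b) \<le> 1" by metis
    \<comment> \<open>The weights add up to 1, so the limits in each coordinate stay in the unit
      ball.\<close>
    have half: "(\<lambda>i. (1/2::real) ^ Suc i) sums 1" by (rule power_half_series)
    have 1: "summable f \<and> norm (suminf f) \<le> 1" if "\<And>i. norm (f i) \<le> (1/2) ^ Suc i"
      for f :: "nat \<Rightarrow> 'c::banach"
    proof
      show "summable f" by (rule summable_comparison_test'[OF sums_summable[OF half]]) (rule that)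
      show "norm (suminf f) \<le> 1"
        using norm_suminf_le[OF that sums_summable[OF half]] sums_unique[OF half] by simp
    qed
    define x' where "x' = (\<Sum>i. (1/2) ^ Suc i *\<^sub>R x i)"
    define c' where "c' b = (\<Sum>i. (1/2) ^ Suc i *\<^sub>R c i b)" for b
    have x': "(\<lambda>i. (1/2) ^ Suc i *\<^sub>R x i) sums x'" "norm x' \<le> 1"
      using 1[of "\<lambda>i. (1/2) ^ Suc i *\<^sub>R x i"] k(2) unfolding x'_def
      by (auto simp: norm_power mult_left_le intro!: summable_sums)
    have c': "(\<lambda>i. (1/2) ^ Suc i *\<^sub>R c i b) sums c' b" "cmod (c' b) \<le> 1" if "b \<in> B" for b
      using 1[of "\<lambda>i. (1/2) ^ Suc i *\<^sub>R c i b"] k(3)[OF that] unfolding c'_def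
      by (auto simp: norm_power norm_mult mult_left_le simp del: scaleR_conv_of_real intro!: summable_sums)
    have "(\<lambda>i. W ((1/2) ^ Suc i *\<^sub>R x i) + (\<Sum>b\<in>B. ((1/2) ^ Suc i *\<^sub>R c i b) *\<^sub>C b)) sums L x' c'"
      unfolding L_def
      by (intro sums_add W.sums x' sums_sum
          bounded_linear.sums[OF bounded_bilinear.bounded_linear_left[OF bounded_bilinear_scaleC]] c')
    moreover have "W ((1/2) ^ Suc i *\<^sub>R x i) + (\<Sum>b\<in>B. ((1/2) ^ Suc i *\<^sub>R c i b) *\<^sub>C b)
        = (1/2) ^ Suc i *\<^sub>R k i" for i
      unfolding k Lscale[symmetric] by (simp add: L_def scaleR_conv_of_real)
    ultimately have "(\<lambda>i. (1/2) ^ Suc i *\<^sub>R k i) sums L x' c'" by (simp only:)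
    then have "y = L x' c'" using sums sums_unique2 by blast
    then show "y \<in> K" using KI x' c' by simp
  qed
  then obtain d where d: "d > 0" "ball 0 d \<subseteq> K" by blast
  have "norm x \<le> (2 / d) * norm (W x)" for x
  proof (cases "x = 0")
    case False
    then have Wx: "norm (W x) > 0" using inj by auto
    define s where "s = d / (2 * norm (W x))"
    have s: "s > 0" using d Wx by (simp add: s_def)
    have "norm (W (s *\<^sub>R x)) = d / 2" using d(1) Wx by (simp add: W.scaleR s_def)
    then have "W (s *\<^sub>R x) \<in> K" using d by (auto simp: subset_iff)
    then obtain x' c where x': "W (s *\<^sub>R x) = L x' c" "norm x' \<le> 1" unfolding K_def by blast
    \<comment> \<open>Two representations of the same vector differ by an element of the span of
      \<open>B\<close> lying in the range of \<open>W\<close>, so the coefficients vanish and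
      injectivity identifies s x with x'.\<close>
    then have sum: "(\<Sum>b\<in>B. c b *\<^sub>C b) = W (s *\<^sub>R x - x')" by (simp add: L_def W.diff)
    then have "\<forall>b\<in>B. c b = 0" by (intro ind) auto
    then have "W (s *\<^sub>R x - x') = 0" unfolding sum[symmetric] by simp
    then have "s *\<^sub>R x = x'" using inj by fastforce
    then have "s * norm x \<le> 1" using x'(2) s by auto
    then show ?thesis using d Wx by (simp add: s_def field_simps)
  qed simp
  then show ?thesis using that[of "2 / d"] d by simp
qed

text \<open>If A - l were injective, W = (A - l) R with a resolvent \<open>R\<close> at another
  point would be a bounded injective operator with the same range. Its lower bound passes to A - l
  because \<open>R\<close> is bounded, and it bounds all resolvents close to l uniformly.\<close>

lemma fredholm_boundary_eigenvector:
  assumes fred: "fredholm (shift_op A l)" and spec: "l \<in> spectrum A"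
    and bdry: "\<And>e. e > 0 \<Longrightarrow> \<exists>\<mu>\<in>resolvent_set A. cmod (\<mu> - l) < e"
  obtains g where "g \<in> fst A" "g \<noteq> 0" "snd A g = l *\<^sub>C g"
proof (rule ccontr)
  note eigenvector = that
  assume "\<not> thesis"
  then have ker: "g = 0" if "g \<in> fst A" "snd A g - l *\<^sub>C g = 0" for g
    using eigenvector[of g] that by auto
  obtain \<mu> where "\<mu> \<in> resolvent_set A" using bdry[OF zero_less_one] by blast
  then obtain R where R: "resolvent_at A \<mu> R" unfolding resolvent_set_iff by blast
  then have Rc: "bounded_clinear R" and RR: "\<And>g. R g \<in> fst A" "\<And>g. snd A (R g) - \<mu> *\<^sub>C R g = g"
    and RL: "\<And>f. f \<in> fst A \<Longrightarrow> R (snd A f - \<mu> *\<^sub>C f) = f"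
    by (auto simp: resolvent_at_def)
  obtain K where K: "K > 0" "\<And>x. norm (R x) \<le> K * norm x" using resolvent_at_bound[OF R] by blast
  define W where "W x = x + (\<mu> - l) *\<^sub>C R x" for x
  have WA: "W x = snd A (R x) - l *\<^sub>C R x" for x
  proof -
    have "snd A (R x) - l *\<^sub>C R x = (snd A (R x) - \<mu> *\<^sub>C R x) + (\<mu> - l) *\<^sub>C R x"
      by (simp add: complexification.scale_left_diff_distrib)
    then show ?thesis by (simp only: RR W_def)
  qed
  have W: "bounded_clinear W"
    unfolding bounded_clinear_iff
  proof (intro conjI allI)
    show "bounded_linear W"
      unfolding W_def
      by (intro bounded_linear_add bounded_linear_ident
          bounded_linear_compose[OF bounded_linear_scaleC_right] bounded_clinear_bounded_linear Rc)
    show "W (c *\<^sub>C x) = c *\<^sub>C W x" for c x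
      by (simp add: W_def bounded_clinear_scaleC[OF Rc] complexification.scale_right_distrib mult.commute)
  qed
  have inj: "x = 0" if "W x = 0" for x
  proof -
    have "R x = 0" using ker RR(1) that WA by simp
    then show ?thesis using that by (simp add: W_def)
  qed
  have "range W = snd (shift_op A l) ` fst (shift_op A l)"
  proof -
    have "fst A = range R" using RR(1) RL by (auto intro: range_eqI[OF sym])
    then show ?thesis by (auto simp: shift_op_def WA)
  qed
  then have "finite_codimensional (range W)" using fred by (simp add: fredholm_def)
  then obtain c where c: "c > 0" "\<And>x. norm x \<le> c * norm (W x)"
    using injective_finite_codim_bounded_below[OF W inj] by metis
  define C where "C = K * c"
  have C0: "C > 0" using K c by (simp add: C_def)
  have C: "norm f \<le> C * norm (snd A f - l *\<^sub>C f)" if f: "f \<in> fst A" for f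
  proof -
    obtain x where x: "f = R x" using RL[OF f] by metis
    have "norm f \<le> K * norm x" using K x by simp
    also have "\<dots> \<le> K * (c * norm (W x))" using K(1) c(2) by simp
    finally show ?thesis by (simp add: C_def WA x mult_ac)
  qed
  \<comment> \<open>Closer than 1 / (4 C), the perturbation costs a quarter of norm (S g), which is
    absorbed and leaves the bound 2 C. For this bound, \<open>resolvent_set_ball\<close> has exactly
    the radius 1 / (4 C).\<close>
  have "1 / (4 * C) > 0" using C0 by simp
  then obtain \<nu> where \<nu>: "\<nu> \<in> resolvent_set A" "cmod (\<nu> - l) < 1 / (4 * C)" using bdry by blast
  obtain S where S: "resolvent_at A \<nu> S" using \<nu> resolvent_set_iff by blast
  have "norm (S g) \<le> 2 * C * norm g" for g
  proof -
    have Sg: "S g \<in> fst A" "snd A (S g) - \<nu> *\<^sub>C S g = g" using S by (auto simp: resolvent_at_def)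
    have "snd A (S g) - l *\<^sub>C S g = (snd A (S g) - \<nu> *\<^sub>C S g) + (\<nu> - l) *\<^sub>C S g"
      by (simp add: complexification.scale_left_diff_distrib)
    then have "snd A (S g) - l *\<^sub>C S g = g + (\<nu> - l) *\<^sub>C S g" by (simp only: Sg)
    then have "norm (S g) \<le> C * norm (g + (\<nu> - l) *\<^sub>C S g)" using C[OF Sg(1)] by simp
    also have "\<dots> \<le> C * (norm g + cmod (\<nu> - l) * norm (S g))"
      using C0 norm_triangle_ineq[of g "(\<nu> - l) *\<^sub>C S g"] by (simp add: norm_scaleC)
    also have "\<dots> \<le> C * (norm g + 1 / (4 * C) * norm (S g))"
      using C0 \<nu>(2) by (intro mult_left_mono add_left_mono mult_right_mono) auto
    also have "\<dots> = C * norm g + norm (S g) / 4" using C0 by (simp add: field_simps)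
    finally have "norm (S g) \<le> C * norm g + norm (S g) / 4" .
    moreover have "0 \<le> C * norm g" using C0 by simp
    ultimately show ?thesis by simp
  qed
  moreover have "cmod (l - \<nu>) \<le> 1 / (2 * (2 * C))" using \<nu>(2) by (simp add: norm_minus_commute)
  ultimately have "l \<in> resolvent_set A" using C0 by (intro resolvent_set_ball[OF S, of "2 * C"]) auto
  then show False using spec by (simp add: spectrum_def)
qed

section \<open>Semigroups and their generators\<close>

locale c0_semigroup =
  fixes T :: "real \<Rightarrow> 'a::real_banach_lattice complexification \<Rightarrow> 'a complexification"
  assumes C0: "C0_semigroup T"
begin

lemma bounded_clinear: "0 \<le> t \<Longrightarrow> bounded_clinear (T t)"
  using C0 by (simp add: C0_semigroup_def)

lemma bounded_linear: "0 \<le> t \<Longrightarrow> bounded_linear (T t)"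
  by (intro bounded_clinear_bounded_linear bounded_clinear)

lemma diff: "0 \<le> t \<Longrightarrow> T t (x - y) = T t x - T t y"
  by (intro linear_diff bounded_linear.linear bounded_linear)

lemma zero_left [simp]: "T 0 x = x"
  using C0 by (simp add: C0_semigroup_def)

lemma add_left: "0 \<le> s \<Longrightarrow> 0 \<le> t \<Longrightarrow> T (s + t) x = T s (T t x)"
  using C0 by (simp add: C0_semigroup_def)

lemma tendsto_zero: "((\<lambda>t. T t x) \<longlongrightarrow> x) (at_right 0)"
  using C0 by (simp add: C0_semigroup_def)

lemma near_zero:
  assumes "e > 0"
  obtains d where "d > 0" "\<And>h. 0 \<le> h \<Longrightarrow> h < d \<Longrightarrow> norm (T h x - x) < e"
proof -
  obtain d where d: "d > 0" "\<And>h. 0 < h \<Longrightarrow> h < d \<Longrightarrow> dist (T h x) x < e"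
    using tendstoD[OF tendsto_zero assms, of x] by (auto simp: eventually_at_right_field)
  have "norm (T h x - x) < e" if "0 \<le> h" "h < d" for h
    using d(2)[of h] that assms by (cases "h = 0") (auto simp: dist_norm)
  then show ?thesis using that d(1) by blast
qed

text \<open>Otherwise there are times tending to 0 at which the operator norms are unbounded, while
  strong continuity at 0 bounds every single orbit along these times. This contradicts uniform
  boundedness.\<close>

lemma bounded_near_zero:
  obtains d K where "d > 0" "K \<ge> 1" "\<And>t x. 0 \<le> t \<Longrightarrow> t \<le> d \<Longrightarrow> norm (T t x) \<le> K * norm x"
proof -
  have "\<exists>n. \<forall>t x. 0 \<le> t \<longrightarrow> t \<le> inverse (real (Suc n)) \<longrightarrow> norm (T t x) \<le> real (Suc n) * norm x"
  proof (rule ccontr)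
    assume "\<not> ?thesis"
    then have "\<forall>n. \<exists>t x. 0 \<le> t \<and> t \<le> inverse (real (Suc n)) \<and> norm (T t x) > real (Suc n) * norm x"
      by (meson not_le)
    then obtain t x where t: "\<And>n. 0 \<le> t n" "\<And>n. t n \<le> inverse (real (Suc n))"
      and x: "\<And>n. norm (T (t n) (x n)) > real (Suc n) * norm (x n)" by metis
    have "\<exists>B. \<forall>n. norm (T (t n) y) \<le> B" for y
    proof -
      have "(\<lambda>n. T (t n) y) \<longlonglongrightarrow> y"
      proof (rule LIMSEQ_I)
        fix e :: real assume "e > 0"
        then obtain d where d: "d > 0" "\<And>h. 0 \<le> h \<Longrightarrow> h < d \<Longrightarrow> norm (T h y - y) < e"
          using near_zero by blast
        obtain N where N: "inverse (real (Suc N)) < d" using d(1) reals_Archimedean by blast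
        have "norm (T (t n) y - y) < e" if "n \<ge> N" for n
        proof (rule d(2)[OF t(1)])
          have "t n \<le> inverse (real (Suc n))" by (rule t)
          also have "\<dots> \<le> inverse (real (Suc N))" using that by (simp add: field_simps)
          finally show "t n < d" using N by simp
        qed
        then show "\<exists>N. \<forall>n\<ge>N. norm (T (t n) y - y) < e" by blast
      qed
      then have "Bseq (\<lambda>n. T (t n) y)" by (simp add: convergent_imp_Bseq convergentI)
      then show ?thesis by (auto simp: Bseq_def)
    qed
    then obtain K where K: "\<And>n y. norm (T (t n) y) \<le> K * norm y"
      using uniform_boundedness[of "\<lambda>n. T (t n)"] bounded_linear t(1) by blast
    obtain n :: nat where "K \<le> real n" using real_arch_simple by blast
    then have "K * norm (x n) \<le> real (Suc n) * norm (x n)" by (intro mult_right_mono) auto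
    then show False using K[of n "x n"] x[of n] by linarith
  qed
  then obtain n where "\<And>t x. 0 \<le> t \<Longrightarrow> t \<le> inverse (real (Suc n)) \<Longrightarrow> norm (T t x) \<le> real (Suc n) * norm x"
    by blast
  then show ?thesis by (intro that[of "inverse (real (Suc n))" "real (Suc n)"]) auto
qed

lemma bounded_on_compact:
  obtains K where "K \<ge> 1" "\<And>t x. 0 \<le> t \<Longrightarrow> t \<le> a \<Longrightarrow> norm (T t x) \<le> K * norm x"
proof -
  obtain d K where d: "d > 0" and K: "K \<ge> 1" "\<And>t x. 0 \<le> t \<Longrightarrow> t \<le> d \<Longrightarrow> norm (T t x) \<le> K * norm x"
    using bounded_near_zero by blast
  \<comment> \<open>Each further interval of length \<open>d\<close> costs one more factor
    \<open>K\<close>.\<close>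
  have *: "norm (T t x) \<le> K ^ Suc n * norm x" if "0 \<le> t" "t \<le> real (Suc n) * d" for n t x
    using that
  proof (induction n arbitrary: t)
    case 0 then show ?case using K by simp
  next
    case (Suc n)
    show ?case
    proof (cases "t \<le> d")
      case True
      then have "norm (T t x) \<le> K * norm x" using K Suc by simp
      also have "\<dots> \<le> K ^ Suc (Suc n) * norm x"
        using K(1) self_le_power[of K "Suc (Suc n)"] by (intro mult_right_mono) auto
      finally show ?thesis .
    next
      case False
      then have "T t x = T d (T (t - d) x)" using d add_left[of d "t - d" x] by simp
      then have "norm (T t x) \<le> K * norm (T (t - d) x)" using K(2)[of d] d by simp
      also have "\<dots> \<le> K * (K ^ Suc n * norm x)"
        using K(1) Suc.prems False by (intro mult_left_mono Suc.IH) (auto simp: algebra_simps)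
      finally show ?thesis by simp
    qed
  qed
  obtain n :: nat where "a / d \<le> real n" using real_arch_simple by blast
  then have "a / d \<le> real (Suc n)" by simp
  then have "a \<le> real (Suc n) * d" using d by (simp add: pos_divide_le_eq del: of_nat_Suc)
  then show ?thesis
    using * K(1) by (intro that[of "K ^ Suc n"] one_le_power) (auto simp del: of_nat_Suc power_Suc)
qed

lemma continuous: "continuous_on {0..} (\<lambda>t. T t x)"
  unfolding continuous_on_iff
proof (intro ballI allI impI)
  fix t e :: real assume t: "t \<in> {0..}" and e: "e > 0"
  obtain K where K: "K \<ge> 1" "\<And>s x. 0 \<le> s \<Longrightarrow> s \<le> t + 1 \<Longrightarrow> norm (T s x) \<le> K * norm x"
    using bounded_on_compact[of "t + 1"] by blast
  have "e / K > 0" using e K by simp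
  then obtain d where d: "d > 0" "\<And>h. 0 \<le> h \<Longrightarrow> h < d \<Longrightarrow> norm (T h x - x) < e / K"
    using near_zero by blast
  \<comment> \<open>Here \<open>s\<close> is the earlier of two times. Factoring out
    \<open>T s\<close> reduces everything to continuity at 0, and the estimate serves for both
    one-sided limits.\<close>
  have inc: "norm (T (s + h) x - T s x) < e" if "0 \<le> s" "s \<le> t + 1" "0 \<le> h" "h < d" for s h
  proof -
    have "T (s + h) x - T s x = T s (T h x - x)" using that by (simp add: add_left diff)
    then have "norm (T (s + h) x - T s x) \<le> K * norm (T h x - x)" using K that by simp
    also have "\<dots> < K * (e / K)" using K d that by (intro mult_strict_left_mono) auto
    finally show ?thesis using K by simp
  qed
  have "dist (T s x) (T t x) < e" if s: "s \<ge> 0" "dist s t < min d 1" for s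
  proof (cases "s \<le> t")
    case True
    then show ?thesis using inc[of s "t - s"] s by (simp add: dist_norm norm_minus_commute)
  next
    case False
    then show ?thesis using inc[of t "s - t"] s t by (simp add: dist_norm)
  qed
  then show "\<exists>d>0. \<forall>s\<in>{0..}. dist s t < d \<longrightarrow> dist (T s x) (T t x) < e"
    using d by (intro exI[of _ "min d 1"]) auto
qed

section \<open>The generator, and its resolvent as a Laplace integral\<close>

lemma generator_eq:
  assumes "((\<lambda>h. (T h f - f) /\<^sub>R h) \<longlongrightarrow> g) (at_right 0)"
  shows "f \<in> fst (generator T)" "snd (generator T) f = g"
  using assms tendsto_Lim[OF _ assms] by (auto simp: generator_def)

lemma generator_tendsto:
  assumes "f \<in> fst (generator T)"
  shows "((\<lambda>h. (T h f - f) /\<^sub>R h) \<longlongrightarrow> snd (generator T) f) (at_right 0)"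
proof -
  obtain g where "((\<lambda>h. (T h f - f) /\<^sub>R h) \<longlongrightarrow> g) (at_right 0)"
    using assms by (auto simp: generator_def)
  then show ?thesis using generator_eq by simp
qed

text \<open>Telescoping over a partition of \<open>[0, t]\<close> into \<open>n\<close> pieces bounds \<open>T t f - f\<close> by
  \<open>K t\<close> times a difference quotient at \<open>0\<close>.\<close>

lemma fixed_of_generator_zero:
  assumes f: "f \<in> fst (generator T)" "snd (generator T) f = 0" and t: "0 \<le> t"
  shows "T t f = f"
proof (cases "t = 0")
  case False
  obtain K where K: "K \<ge> 1" "\<And>s x. 0 \<le> s \<Longrightarrow> s \<le> t \<Longrightarrow> norm (T s x) \<le> K * norm x"
    using bounded_on_compact[of t] by blast
  define h where "h n = t / real (Suc n)" for n
  have h: "h n > 0" for n using False t by (simp add: h_def)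
  have tele: "norm (T (real k * h n) f - f) \<le> real k * (K * norm (T (h n) f - f))" if "k \<le> Suc n" for k n
    using that
  proof (induction k)
    case (Suc k)
    have "real k * h n \<le> real (Suc n) * h n"
      using h[of n] Suc.prems by (intro mult_right_mono) auto
    then have kh: "0 \<le> real k * h n" "real k * h n \<le> t"
      using h[of n] by (simp, simp add: h_def del: of_nat_Suc)
    have "T (real (Suc k) * h n) f = T (real k * h n) (T (h n) f)"
      using kh h[of n] by (simp add: add_left[symmetric] algebra_simps)
    then have "T (real (Suc k) * h n) f - f = T (real k * h n) (T (h n) f - f) + (T (real k * h n) f - f)"
      using kh by (simp add: diff)
    then have "norm (T (real (Suc k) * h n) f - f)
        \<le> norm (T (real k * h n) (T (h n) f - f)) + norm (T (real k * h n) f - f)"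
      by (simp only: norm_triangle_ineq)
    also have "\<dots> \<le> K * norm (T (h n) f - f) + real k * (K * norm (T (h n) f - f))"
      using Suc by (intro add_mono K kh) auto
    finally show ?case by (simp add: algebra_simps)
  qed simp
  have "norm (T t f - f) \<le> K * t * norm ((T (h n) f - f) /\<^sub>R h n)" for n
  proof -
    have "real (Suc n) * h n = t" by (simp add: h_def del: of_nat_Suc)
    then have "norm (T t f - f) \<le> real (Suc n) * (K * norm (T (h n) f - f))"
      using tele[of "Suc n" n] by simp
    also have "\<dots> = K * t * (norm (T (h n) f - f) / h n)"
      unfolding \<open>real (Suc n) * h n = t\<close>[symmetric] using h[of n] by simp
    also have "norm (T (h n) f - f) / h n = norm ((T (h n) f - f) /\<^sub>R h n)"
      using h[of n] by (simp add: divide_inverse mult.commute del: scaleR_diff_right)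
    finally show ?thesis .
  qed
  moreover have "(\<lambda>n. K * t * norm ((T (h n) f - f) /\<^sub>R h n)) \<longlonglongrightarrow> K * t * norm (0 :: 'a complexification)"
  proof (intro tendsto_intros)
    have "h \<longlonglongrightarrow> 0" unfolding h_def by (rule lim_const_over_n[THEN LIMSEQ_Suc])
    then have "filterlim h (at_right 0) sequentially"
      using h by (auto simp: filterlim_at less_imp_neq[symmetric])
    then show "(\<lambda>n. (T (h n) f - f) /\<^sub>R h n) \<longlonglongrightarrow> 0"
      using generator_tendsto[OF f(1)] f(2) filterlim_compose by fastforce
  qed
  ultimately have "norm (T t f - f) \<le> K * t * norm (0 :: 'a complexification)"
    by (intro LIMSEQ_le_const) auto
  then show ?thesis by simp
qed simp

text \<open>Averaging over a unit of time maps into the domain and turns the generator into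
  \<open>T 1\<close> - I. Inverting the latter by a Neumann series therefore inverts the
  generator.\<close>

definition J :: "'a complexification \<Rightarrow> 'a complexification"
  where "J x = integral {0..1} (\<lambda>t. T t x)"

lemma integrable: "(\<lambda>t. T t x) integrable_on {0..a}"
  by (intro integrable_continuous_real continuous_on_subset[OF continuous]) auto

lemma bounded_clinear_J: "bounded_clinear J"
proof -
  obtain K where "K \<ge> 1" and K: "\<And>t x. 0 \<le> t \<Longrightarrow> t \<le> 1 \<Longrightarrow> norm (T t x) \<le> K * norm x"
    using bounded_on_compact[of 1] by blast
  have "J (x + y) = J x + J y" for x y
    unfolding J_def integral_add[OF integrable integrable, symmetric]
    by (intro integral_cong linear_add bounded_linear.linear bounded_linear) auto
  moreover have cl: "J (c *\<^sub>C x) = c *\<^sub>C J x" for c x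
    unfolding J_def integral_linear[OF integrable bounded_linear_scaleC_right, symmetric] o_def
    by (intro integral_cong bounded_clinear_scaleC bounded_clinear) auto
  moreover have "norm (J x) \<le> K * norm x" for x
    unfolding J_def
    using integral_bound[of 0 1 "\<lambda>t. T t x" "K * norm x"] continuous_on_subset[OF continuous] K by simp
  ultimately show ?thesis unfolding bounded_clinear_def clinear_iff by blast
qed

lemma J_commute:
  assumes "bounded_linear L" "\<And>t y. 0 \<le> t \<Longrightarrow> L (T t y) = T t (L y)"
  shows "L (J x) = J (L x)"
  unfolding J_def integral_linear[OF integrable assms(1), symmetric] o_def
  by (intro integral_cong assms(2)) simp

lemma T_commute: "0 \<le> s \<Longrightarrow> 0 \<le> t \<Longrightarrow> T s (T t x) = T t (T s x)"
  by (metis add.commute add_left)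

lemma average_tendsto:
  assumes "0 \<le> a"
  shows "((\<lambda>h. (integral {0..a + h} (\<lambda>t. T t x) - integral {0..a} (\<lambda>t. T t x)) /\<^sub>R h)
    \<longlongrightarrow> T a x) (at_right 0)"
proof (rule tendstoI)
  let ?F = "\<lambda>u. integral {0..u} (\<lambda>t. T t x)"
  fix e :: real assume "e > 0"
  have "(?F has_vector_derivative T a x) (at a within {0..a + 1})"
    using assms by (intro integral_has_vector_derivative continuous_on_subset[OF continuous]) auto
  then have "\<exists>d>0. \<forall>y\<in>{0..a + 1}. norm (y - a) < d \<longrightarrow>
      norm (?F y - ?F a - (y - a) *\<^sub>R T a x) \<le> e / 2 * norm (y - a)"
    unfolding has_vector_derivative_def has_derivative_within_alt
    using half_gt_zero[OF \<open>e > 0\<close>] by (elim conjE allE[of _ "e / 2"]) simp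
  then obtain d where d: "d > 0" "\<And>y. y \<in> {0..a + 1} \<Longrightarrow> norm (y - a) < d \<Longrightarrow>
      norm (?F y - ?F a - (y - a) *\<^sub>R T a x) \<le> e / 2 * norm (y - a)" by auto
  have "dist ((?F (a + h) - ?F a) /\<^sub>R h) (T a x) < e" if h: "0 < h" "h < min d 1" for h
  proof -
    have "norm (?F (a + h) - ?F a - h *\<^sub>R T a x) \<le> e / 2 * h"
      using d(2)[of "a + h"] h assms by simp
    then have "norm (?F (a + h) - ?F a - h *\<^sub>R T a x) / h \<le> e / 2"
      using h by (simp only: pos_divide_le_eq)
    moreover have "(?F (a + h) - ?F a) /\<^sub>R h - T a x = (?F (a + h) - ?F a - h *\<^sub>R T a x) /\<^sub>R h"
      using h by (simp add: scaleR_diff_right)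
    then have "norm ((?F (a + h) - ?F a) /\<^sub>R h - T a x) = norm (?F (a + h) - ?F a - h *\<^sub>R T a x) / h"
      using h by (simp add: divide_inverse mult.commute del: scaleR_diff_right)
    ultimately have "norm ((?F (a + h) - ?F a) /\<^sub>R h - T a x) \<le> e / 2" by simp
    then show ?thesis using \<open>e > 0\<close> by (simp add: dist_norm)
  qed
  then show "\<forall>\<^sub>F h in at_right 0. dist ((?F (a + h) - ?F a) /\<^sub>R h) (T a x) < e"
    unfolding eventually_at_right_field using d(1) by (intro exI[of _ "min d 1"]) auto
qed

text \<open>Applying \<open>T h\<close> - I to the integral over [0, 1] leaves the integral over
  [1, 1 + h] minus the one over [0, h]; divided by h these tend to \<open>T 1 x\<close> and
  x.\<close>

lemma generator_J: "J x \<in> fst (generator T)" "snd (generator T) (J x) = T 1 x - x"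
proof -
  let ?F = "\<lambda>u. integral {0..u} (\<lambda>t. T t x)"
  have eq: "(T h (J x) - J x) /\<^sub>R h = (?F (1 + h) - ?F 1) /\<^sub>R h - (?F (0 + h) - ?F 0) /\<^sub>R h" if "h > 0" for h
  proof -
    have "T h (J x) = integral {0..1} (\<lambda>t. T h (T t x))"
      using integral_linear[OF integrable bounded_linear[of h]] that by (simp add: J_def o_def)
    also have "\<dots> = integral {0..1} ((\<lambda>t. T t x) \<circ> (+) h)"
      using that by (intro integral_cong) (simp add: add_left)
    also have "\<dots> = integral {h..1 + h} (\<lambda>t. T t x)"
      by (simp add: integral_shift_Icc_real)
    also have "\<dots> = ?F (1 + h) - ?F h"
      using Henstock_Kurzweil_Integration.integral_combine[where a = 0 and c = h and b = "1 + h" and f = "\<lambda>t. T t x"] integrable that by (simp add: algebra_simps)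
    finally show ?thesis by (simp add: J_def scaleR_diff_right)
  qed
  have "((\<lambda>h. (?F (1 + h) - ?F 1) /\<^sub>R h - (?F (0 + h) - ?F 0) /\<^sub>R h) \<longlongrightarrow> T 1 x - x) (at_right 0)"
    using tendsto_diff[OF average_tendsto[of 1 x] average_tendsto[of 0 x]] by simp
  then have "((\<lambda>h. (T h (J x) - J x) /\<^sub>R h) \<longlongrightarrow> T 1 x - x) (at_right 0)"
    by (rule Lim_transform_eventually)
       (auto simp: eq eventually_at_right_field intro!: exI[of _ 1])
  then show "J x \<in> fst (generator T)" "snd (generator T) (J x) = T 1 x - x"
    by (rule generator_eq)+
qed

text \<open>\<open>J\<close> is continuous and commutes with the difference quotients, so it
  commutes with the generator on its domain.\<close>

lemma J_generator:
  assumes "f \<in> fst (generator T)"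
  shows "J (snd (generator T) f) = T 1 f - f"
proof -
  interpret J: bounded_linear J by (rule bounded_clinear_bounded_linear[OF bounded_clinear_J])
  have "((\<lambda>h. J ((T h f - f) /\<^sub>R h)) \<longlongrightarrow> J (snd (generator T) f)) (at_right 0)"
    by (rule J.tendsto[OF generator_tendsto[OF assms]])
  moreover have "J ((T h f - f) /\<^sub>R h) = (T h (J f) - J f) /\<^sub>R h" if "h > 0" for h
    using that J_commute[OF bounded_linear[of h] T_commute] by (simp add: J.scaleR J.diff)
  then have "\<forall>\<^sub>F h in at_right 0. J ((T h f - f) /\<^sub>R h) = (T h (J f) - J f) /\<^sub>R h"
    by (auto simp: eventually_at_right_field intro!: exI[of _ 1])
  ultimately have "((\<lambda>h. (T h (J f) - J f) /\<^sub>R h) \<longlongrightarrow> J (snd (generator T) f)) (at_right 0)"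
    by (rule Lim_transform_eventually)
  then show ?thesis using generator_eq(2) generator_J(2) by metis
qed

text \<open>The Laplace integral \<open>- \<integral>\<^sub>0\<^sup>\<infinity> T t x dt\<close>, written as a geometric series of integrals
  over \<open>[0, 1]\<close> so that no improper vector-valued integral is needed.\<close>

lemma resolvent_at_zero:
  assumes q: "\<And>x. norm (T 1 x) \<le> q * norm x" "0 \<le> q" "q < 1"
  shows "resolvent_at (generator T) 0 (\<lambda>x. - J (neumann (T 1) x))"
proof -
  interpret N: strict_contraction "T 1" q
    using q by (intro strict_contraction.intro strict_contraction_axioms.intro bounded_linear) auto
  interpret J: bounded_linear J by (rule bounded_clinear_bounded_linear[OF bounded_clinear_J])
  have Nc: "bounded_clinear (neumann (T 1))"
    by (rule bounded_clinear_neumann[OF N.strict_contraction_axioms])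
       (simp add: bounded_clinear_scaleC bounded_clinear)
  interpret NN: bounded_linear "neumann (T 1)" by (rule N.bounded_linear_neumann)
  have "bounded_clinear (\<lambda>x. - J (neumann (T 1) x))"
    unfolding bounded_clinear_iff
    by (intro conjI allI bounded_linear_minus bounded_linear_compose[OF J.bounded_linear_axioms]
         NN.bounded_linear_axioms)
       (simp add: bounded_clinear_scaleC[OF Nc] bounded_clinear_scaleC[OF bounded_clinear_J])
  moreover have "- J (neumann (T 1) g) \<in> fst (generator T)"
    "snd (generator T) (- J (neumann (T 1) g)) = g" for g
    \<comment> \<open>The minus sign is moved into the argument: the generator sends
      \<open>J y\<close> to \<open>T 1 y - y\<close>, and y is minus the Neumann series of
      g.\<close>
    using generator_J[of "- neumann (T 1) g"] N.neumann_right[of g]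
    by (simp_all add: J.neg N.neg algebra_simps)
  moreover have "- J (neumann (T 1) (snd (generator T) f)) = f" if "f \<in> fst (generator T)" for f
  proof -
    have "J (neumann (T 1) y) = neumann (T 1) (J y)" for y
      by (rule N.neumann_commute[OF J.bounded_linear_axioms])
         (rule J_commute[OF bounded_linear T_commute, symmetric]; simp)
    then have "- J (neumann (T 1) (snd (generator T) f)) = - neumann (T 1) (T 1 f - f)"
      using J_generator[OF that] by simp
    also have "\<dots> = neumann (T 1) (f - T 1 f)" by (simp add: NN.neg[symmetric])
    finally show ?thesis by (simp only: N.neumann_left)
  qed
  ultimately show ?thesis by (simp add: resolvent_at_def)
qed

end

text \<open>The semigroup generated by A - l. It moves a chosen point of the complex plane to 0, so
  that resolvents and eigenvectors need only be studied there.\<close>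

definition rescale ::
    "complex \<Rightarrow> (real \<Rightarrow> 'a::real_banach_lattice complexification \<Rightarrow> 'a complexification)
      \<Rightarrow> real \<Rightarrow> 'a complexification \<Rightarrow> 'a complexification"
  where "rescale l T = (\<lambda>t x. exp (t *\<^sub>R (- l)) *\<^sub>C T t x)"

lemma rescale_rescale: "rescale l (rescale m T) = rescale (l + m) T"
  by (simp add: rescale_def fun_eq_iff exp_add[symmetric] algebra_simps)

lemma rescale_zero [simp]: "rescale 0 T = T"
  by (simp add: rescale_def)

lemma exp_quotient_tendsto:
  "((\<lambda>h. (exp (h *\<^sub>R c) - 1) /\<^sub>R h) \<longlongrightarrow> c) (at_right 0)" for c :: complex
proof -
  have "((\<lambda>z. exp (z * c)) has_field_derivative c) (at 0)"
    by (auto intro!: derivative_eq_intros)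
  then have "((\<lambda>h. (exp (h * c) - 1) / h) \<longlongrightarrow> c) (at 0)"
    by (simp add: DERIV_def)
  moreover have "filterlim complex_of_real (at 0) (at_right 0)"
    by (auto simp: filterlim_at eventually_at_right_field intro!: tendsto_eq_intros exI[of _ 1])
  ultimately have "((\<lambda>h. (exp (complex_of_real h * c) - 1) / complex_of_real h) \<longlongrightarrow> c) (at_right 0)"
    by (rule filterlim_compose)
  then show ?thesis by (simp add: scaleR_conv_of_real divide_inverse mult.commute)
qed

context c0_semigroup
begin

lemma rescale: "c0_semigroup (rescale l T)"
proof
  show "C0_semigroup (rescale l T)"
    unfolding C0_semigroup_def
  proof (intro conjI allI impI)
    show "bounded_clinear (rescale l T t)" if "0 \<le> t" for t
      using bounded_clinear[OF that] bounded_linear_compose[OF bounded_linear_scaleC_right, of "T t"]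
      unfolding rescale_def bounded_clinear_iff by (simp add: mult.commute)
    show "rescale l T 0 = id" by (simp add: rescale_def fun_eq_iff)
    show "rescale l T (s + t) = rescale l T s \<circ> rescale l T t" if "0 \<le> s" "0 \<le> t" for s t
      using that
      by (simp add: rescale_def fun_eq_iff add_left bounded_clinear_scaleC[OF bounded_clinear]
          scaleR_add_left exp_add[symmetric] algebra_simps)
    have "((\<lambda>t. exp (t *\<^sub>R (- l)) *\<^sub>C T t f) \<longlongrightarrow> exp (0 *\<^sub>R (- l)) *\<^sub>C f) (at_right 0)" for f
      by (intro tendsto_scaleC tendsto_zero tendsto_intros)
    then show "((\<lambda>t. rescale l T t f) \<longlongrightarrow> f) (at_right 0)" for f
      by (simp add: rescale_def)
  qed
qed

lemma generator_rescale_aux: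
  assumes "((\<lambda>h. (T h f - f) /\<^sub>R h) \<longlongrightarrow> g) (at_right 0)"
  shows "((\<lambda>h. (rescale l T h f - f) /\<^sub>R h) \<longlongrightarrow> g - l *\<^sub>C f) (at_right 0)"
proof -
  have "(rescale l T h f - f) /\<^sub>R h
      = exp (h *\<^sub>R (- l)) *\<^sub>C ((T h f - f) /\<^sub>R h) + ((exp (h *\<^sub>R (- l)) - 1) /\<^sub>R h) *\<^sub>C f" for h
    unfolding rescale_def
    by (simp add: scaleR_complexification_def complexification.scale_left_diff_distrib
        complexification.scale_right_diff_distrib scaleR_conv_of_real algebra_simps)
  moreover have "((\<lambda>h. exp (h *\<^sub>R (- l)) *\<^sub>C ((T h f - f) /\<^sub>R h) + ((exp (h *\<^sub>R (- l)) - 1) /\<^sub>R h) *\<^sub>C f)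
      \<longlongrightarrow> exp (0 *\<^sub>R (- l)) *\<^sub>C g + (- l) *\<^sub>C f) (at_right 0)"
    by (intro tendsto_add tendsto_scaleC assms exp_quotient_tendsto tendsto_intros)
  ultimately show ?thesis by simp
qed

lemma generator_rescale_subset:
  assumes "f \<in> fst (generator T)"
  shows "f \<in> fst (generator (rescale l T))"
    "snd (generator (rescale l T)) f = snd (generator T) f - l *\<^sub>C f"
proof -
  interpret R: c0_semigroup "rescale l T" by (rule rescale)
  show "f \<in> fst (generator (rescale l T))"
    "snd (generator (rescale l T)) f = snd (generator T) f - l *\<^sub>C f"
    by (rule R.generator_eq[OF generator_rescale_aux[OF generator_tendsto[OF assms]]])+
qed

lemma generator_rescale:
  "fst (generator (rescale l T)) = fst (generator T)"
  "f \<in> fst (generator T) \<Longrightarrow> snd (generator (rescale l T)) f = snd (generator T) f - l *\<^sub>C f"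
proof -
  interpret R: c0_semigroup "rescale l T" by (rule rescale)
  show "fst (generator (rescale l T)) = fst (generator T)"
    \<comment> \<open>The reverse inclusion of domains is the same fact for the rescaled semigroup,
      which rescaling by - l takes back to \<open>T\<close>.\<close>
    using R.generator_rescale_subset(1)[of _ "- l"] generator_rescale_subset(1)[of _ l]
    by (auto simp: rescale_rescale)
qed (rule generator_rescale_subset)

lemma resolvent_at_rescale:
  "resolvent_at (generator (rescale l T)) m R \<longleftrightarrow> resolvent_at (generator T) (l + m) R"
proof -
  have "snd (generator (rescale l T)) f - m *\<^sub>C f = snd (generator T) f - (l + m) *\<^sub>C f"
    if "f \<in> fst (generator T)" for f
    using generator_rescale(2)[OF that, of l] by (simp add: complexification.scale_left_distrib)
  then show ?thesis unfolding resolvent_at_def generator_rescale(1) by (metis (no_types, lifting))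
qed

lemma norm_rescale: "norm (rescale l T t x) = exp (- t * Re l) * norm (T t x)"
  by (simp add: rescale_def norm_scaleC)

text \<open>It suffices that the operator at time 1 contracts, since the Laplace integral is a
  series in its powers. The threshold is ln K for a bound \<open>K\<close> on [0, 1].\<close>

lemma rescale_contraction:
  obtains w where "\<And>l. w < Re l \<Longrightarrow> \<exists>q. 0 \<le> q \<and> q < 1 \<and> (\<forall>x. norm (rescale l T 1 x) \<le> q * norm x)"
proof -
  obtain K where K: "K \<ge> 1" "\<And>t x. 0 \<le> t \<Longrightarrow> t \<le> 1 \<Longrightarrow> norm (T t x) \<le> K * norm x"
    using bounded_on_compact[of 1] by blast
  have "\<exists>q. 0 \<le> q \<and> q < 1 \<and> (\<forall>x. norm (rescale l T 1 x) \<le> q * norm x)" if "ln K < Re l" for l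
  proof (intro exI[of _ "exp (- Re l) * K"] conjI allI)
    have "K < exp (Re l)" using exp_less_mono[OF that] K(1) by simp
    then show "exp (- Re l) * K < 1" by (simp add: exp_minus field_simps)
    show "0 \<le> exp (- Re l) * K" using K by simp
    show "norm (rescale l T 1 x) \<le> exp (- Re l) * K * norm x" for x
      using K(2)[of 1 x] by (simp add: norm_rescale)
  qed
  then show ?thesis by (rule that)
qed

lemma half_plane_resolvent_set:
  obtains w where "\<And>l. w < Re l \<Longrightarrow> l \<in> resolvent_set (generator T)"
proof -
  obtain w where w: "\<And>l. w < Re l \<Longrightarrow> \<exists>q. 0 \<le> q \<and> q < 1 \<and> (\<forall>x. norm (rescale l T 1 x) \<le> q * norm x)"
    using rescale_contraction by blast
  have "l \<in> resolvent_set (generator T)" if "w < Re l" for l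
  proof -
    interpret R: c0_semigroup "rescale l T" by (rule rescale)
    obtain q where "0 \<le> q" "q < 1" "\<And>x. norm (rescale l T 1 x) \<le> q * norm x" using w \<open>w < Re l\<close> by blast
    then show ?thesis
      using R.resolvent_at_zero unfolding resolvent_at_rescale resolvent_set_iff by (auto intro: exI)
  qed
  then show ?thesis by (rule that)
qed

lemma eigenvector_semigroup:
  assumes f: "f \<in> fst (generator T)" "snd (generator T) f = l *\<^sub>C f" and t: "0 \<le> t"
  shows "T t f = exp (t *\<^sub>R l) *\<^sub>C f"
proof -
  interpret R: c0_semigroup "rescale l T" by (rule rescale)
  have "rescale l T t f = f"
    using f t by (intro R.fixed_of_generator_zero) (simp_all add: generator_rescale)
  then have "exp (t *\<^sub>R l) *\<^sub>C f = exp (t *\<^sub>R l) *\<^sub>C rescale l T t f" by simp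
  also have "\<dots> = T t f" by (simp add: rescale_def exp_add[symmetric])
  finally show ?thesis by simp
qed

end

section \<open>Positivity along the real axis\<close>

lemma positive_cone_iff: "z \<in> positive_cone \<longleftrightarrow> im_part z = 0 \<and> 0 \<le> re_part z"
  by (cases z) (auto simp: positive_cone_def)

lemma positive_cone_zero: "0 \<in> positive_cone"
  by (simp add: positive_cone_iff)

lemma positive_cone_add: "z \<in> positive_cone \<Longrightarrow> w \<in> positive_cone \<Longrightarrow> z + w \<in> positive_cone"
  by (simp add: positive_cone_iff)

lemma positive_cone_scaleR: "0 \<le> c \<Longrightarrow> z \<in> positive_cone \<Longrightarrow> c *\<^sub>R z \<in> positive_cone"
  by (simp add: positive_cone_iff scaleR_nonneg_nonneg)

lemma closed_positive_cone: "closed (positive_cone :: 'a::real_banach_lattice complexification set)"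
  unfolding closed_sequential_limits
proof (intro allI impI)
  fix X and z :: "'a complexification"
  assume X: "(\<forall>n. X n \<in> positive_cone) \<and> X \<longlonglongrightarrow> z"
  have "bounded_linear (re_part :: 'a complexification \<Rightarrow> 'a)"
    "bounded_linear (im_part :: 'a complexification \<Rightarrow> 'a)"
    by (auto intro!: bounded_linear_intro[of _ 1] simp: norm_parts_le)
  then have "(\<lambda>n. re_part (X n)) \<longlonglongrightarrow> re_part z" "(\<lambda>n. im_part (X n)) \<longlonglongrightarrow> im_part z"
    using X bounded_linear.tendsto by blast+
  then show "z \<in> positive_cone"
    using X lattice_nonneg_limit[of "\<lambda>n. re_part (X n)"]
    by (simp add: positive_cone_iff LIMSEQ_const_iff)
qed

lemma modulus_positive_cone: "z \<in> positive_cone \<Longrightarrow> modulus z \<le> re_part z"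
  using modulus_le[of z] by (simp add: positive_cone_iff)

lemma norm_positive_cone: "z \<in> positive_cone \<Longrightarrow> norm z = norm (re_part z)"
  using norm_parts_le(1)[of z] norm_le_parts[of z] by (simp add: positive_cone_iff)

text \<open>Real and imaginary part are each split as |x| - (|x| - x); the second term has norm at
  most 2 norm x, whence the constant 2.\<close>

lemma positive_decomposition:
  fixes z :: "'a::real_banach_lattice complexification"
  obtains a b c d where "a \<in> positive_cone" "b \<in> positive_cone" "c \<in> positive_cone" "d \<in> positive_cone"
    "z = (a - b) + \<i> *\<^sub>C (c - d)"
    "norm a \<le> 2 * norm z" "norm b \<le> 2 * norm z" "norm c \<le> 2 * norm z" "norm d \<le> 2 * norm z"
proof -
  have nonneg: "0 \<le> \<bar>x\<bar> - x" for x :: 'a by (simp add: abs_ge_self)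
  have norm1: "norm (Cx x 0) = norm x" if "0 \<le> x" for x :: 'a
    using that norm_positive_cone[of "Cx x 0"] by (simp add: positive_cone_iff)
  have norm2: "norm (\<bar>x\<bar> - x) \<le> 2 * norm x" for x :: 'a
    using norm_triangle_ineq4[of "\<bar>x\<bar>" x] by simp
  show ?thesis
  proof (rule that[of "Cx \<bar>re_part z\<bar> 0" "Cx (\<bar>re_part z\<bar> - re_part z) 0"
        "Cx \<bar>im_part z\<bar> 0" "Cx (\<bar>im_part z\<bar> - im_part z) 0"])
    show "z = (Cx \<bar>re_part z\<bar> 0 - Cx (\<bar>re_part z\<bar> - re_part z) 0)
        + \<i> *\<^sub>C (Cx \<bar>im_part z\<bar> 0 - Cx (\<bar>im_part z\<bar> - im_part z) 0)"
      by (simp add: complexification_eq_iff)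
    show "norm (Cx \<bar>re_part z\<bar> 0) \<le> 2 * norm z" "norm (Cx \<bar>im_part z\<bar> 0) \<le> 2 * norm z"
      using norm_parts_le[of z] norm_ge_zero[of z] by (simp_all only: norm1 abs_ge_zero norm_lattice_abs)
    show "norm (Cx (\<bar>re_part z\<bar> - re_part z) 0) \<le> 2 * norm z"
      "norm (Cx (\<bar>im_part z\<bar> - im_part z) 0) \<le> 2 * norm z"
      using norm_parts_le[of z] norm2[of "re_part z"] norm2[of "im_part z"]
      by (simp_all only: norm1 nonneg)
  qed (simp_all add: positive_cone_iff abs_ge_self)
qed

text \<open>Positivity is asked at four vectors instead of for \<open>Q\<close> as a whole because
  the LEP property provides it one vector at a time, each after its own waiting time.\<close>

lemma modulus_le_of_positive_parts:
  assumes "Q a \<in> positive_cone" "Q b \<in> positive_cone" "Q c \<in> positive_cone" "Q d \<in> positive_cone"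
    and Q: "clinear Q"
  shows "modulus (Q ((a - b) + \<i> *\<^sub>C (c - d))) \<le> re_part (Q (a + b + c + d))"
proof -
  have Qadd: "Q (x + y) = Q x + Q y" and Qs: "Q (k *\<^sub>C x) = k *\<^sub>C Q x" for x y k
    using Q by (auto simp: clinear_iff)
  have neg: "x - y = x + (- 1) *\<^sub>C y" for x y :: "'a complexification" by simp
  have tri: "modulus (x + k *\<^sub>C y) \<le> modulus x + modulus y" if "cmod k = 1"
    for x y :: "'a complexification" and k
    using modulus_triangle[of x "k *\<^sub>C y"] that by (simp add: modulus_scaleC)
  have "modulus (Q ((a - b) + \<i> *\<^sub>C (c - d)))
      = modulus ((Q a + (- 1) *\<^sub>C Q b) + \<i> *\<^sub>C (Q c + (- 1) *\<^sub>C Q d))"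
    by (simp only: neg Qadd Qs)
  also have "\<dots> \<le> (modulus (Q a) + modulus (Q b)) + (modulus (Q c) + modulus (Q d))"
    by (rule order_trans[OF tri add_mono[OF tri tri]]) auto
  also have "\<dots> \<le> (re_part (Q a) + re_part (Q b)) + (re_part (Q c) + re_part (Q d))"
    by (intro add_mono modulus_positive_cone assms)
  finally show ?thesis by (simp add: Qadd algebra_simps)
qed

text \<open>On the cone, 0 <= P_n f <= lim P_k f = f, so norms do not increase there. A general f
  has four positive parts of norm at most 2 norm f, hence the constant 8.\<close>

lemma bounded_clinear_of_increasing_positive:
  assumes pos: "\<And>n. positive_operator (P n)"
    and incr: "\<And>n. positive_operator (\<lambda>f. P (Suc n) f - P n f)"
    and lim: "\<And>f. (\<lambda>n. P n f) \<longlonglongrightarrow> f"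
  shows "bounded_clinear (P n)"
proof -
  have mono: "P (n + k) f - P n f \<in> positive_cone" if f: "f \<in> positive_cone" for f k
  proof (induction k)
    case (Suc k)
    have "P (Suc (n + k)) f - P (n + k) f \<in> positive_cone"
      using incr[of "n + k"] f by (auto simp: positive_operator_def)
    from positive_cone_add[OF Suc this] show ?case by simp
  qed (simp add: positive_cone_zero)
  have cone: "norm (P n f) \<le> norm f" if f: "f \<in> positive_cone" for f
  proof -
    have "(\<lambda>k. P (n + k) f) \<longlonglongrightarrow> f"
      using LIMSEQ_ignore_initial_segment[OF lim[of f], of n] by (simp add: add.commute)
    then have "(\<lambda>k. P (n + k) f - P n f) \<longlonglongrightarrow> f - P n f" by (intro tendsto_intros)
    then have "f - P n f \<in> positive_cone"
      by (rule closed_sequentially[OF closed_positive_cone mono[OF f]])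
    moreover have "P n f \<in> positive_cone" using pos[of n] f by (auto simp: positive_operator_def)
    ultimately show ?thesis
      using norm_mono_nonneg[of "re_part (P n f)" "re_part f"] norm_parts_le(1)[of f]
      by (simp add: norm_positive_cone positive_cone_iff)
  qed
  have lin: "clinear (P n)" using pos[of n] by (simp add: positive_operator_def)
  have "norm (P n f) \<le> 8 * norm f" for f
  proof -
    obtain a b c d where abcd: "a \<in> positive_cone" "b \<in> positive_cone" "c \<in> positive_cone" "d \<in> positive_cone"
      and f: "f = (a - b) + \<i> *\<^sub>C (c - d)"
      and norms: "norm a \<le> 2 * norm f" "norm b \<le> 2 * norm f" "norm c \<le> 2 * norm f" "norm d \<le> 2 * norm f"
      using positive_decomposition[of f] by metis
    have Pcone: "P n x \<in> positive_cone" if "x \<in> positive_cone" for x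
      using pos[of n] that by (auto simp: positive_operator_def)
    have "modulus (P n f) \<le> re_part (P n (a + b + c + d))"
      unfolding f using abcd by (intro modulus_le_of_positive_parts Pcone lin)
    then have "norm (P n f) \<le> norm (re_part (P n (a + b + c + d)))"
      unfolding norm_complexification_def by (rule norm_mono_nonneg[OF modulus_nonneg])
    also have "\<dots> \<le> norm (P n (a + b + c + d))" by (rule norm_parts_le)
    also have "\<dots> \<le> norm (a + b + c + d)" using abcd by (intro cone positive_cone_add)
    also have "\<dots> \<le> norm a + norm b + norm c + norm d"
      by (intro norm_triangle_le add_mono order_refl)
    also have "\<dots> \<le> 8 * norm f" using norms by simp
    finally show ?thesis .
  qed
  then show ?thesis using lin unfolding bounded_clinear_def by blast
qed

section \<open>Lower bounds along orbits and their propagation through the resolvent\<close>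

locale cone_bound = c0_semigroup T
  for T :: "real \<Rightarrow> 'a::real_banach_lattice complexification \<Rightarrow> 'a complexification" +
  fixes Q :: "'a complexification \<Rightarrow> 'b::banach" and K :: "'b set" and v :: 'b
  assumes Q: "bounded_linear Q" and K_closed: "closed K" and K_zero: "0 \<in> K"
    and K_add: "x \<in> K \<Longrightarrow> y \<in> K \<Longrightarrow> x + y \<in> K"
    and K_scaleR: "0 \<le> c \<Longrightarrow> x \<in> K \<Longrightarrow> c *\<^sub>R x \<in> K"
begin

text \<open>In the order defined by \<open>K\<close>: the orbit of x, seen through \<open>Q\<close>,
  stays above r v at all future times. The quantifier over s gives invariance under \<open>T\<close>
  even when \<open>Q\<close> does not commute with it. The later instance has Q = P_n, v = |P_n g|
  and the positive cone for \<open>K\<close>.\<close>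

definition C :: "real \<Rightarrow> 'a complexification set"
  where "C r = {x. \<forall>s\<ge>0. Q (T s x) - r *\<^sub>R v \<in> K}"

lemma QT: "0 \<le> s \<Longrightarrow> bounded_linear (\<lambda>x. Q (T s x))"
  by (rule bounded_linear_compose[OF Q bounded_linear])

text \<open>Closedness jointly in vector and level, as in a Neumann series the level converges along
  with the partial sums.\<close>

lemma C_limit:
  assumes "\<And>n. X n \<in> C (r n)" "X \<longlonglongrightarrow> x" "r \<longlonglongrightarrow> q"
  shows "x \<in> C q"
  unfolding C_def
proof (intro CollectI allI impI)
  fix s :: real assume "0 \<le> s"
  then have mem: "\<And>n. Q (T s (X n)) - r n *\<^sub>R v \<in> K" using assms(1) by (auto simp: C_def)
  have "(\<lambda>n. Q (T s (X n)) - r n *\<^sub>R v) \<longlonglongrightarrow> Q (T s x) - q *\<^sub>R v"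
    using \<open>0 \<le> s\<close> by (intro tendsto_intros bounded_linear.tendsto[OF QT] assms)
  then show "Q (T s x) - q *\<^sub>R v \<in> K" by (rule closed_sequentially[OF K_closed mem])
qed

lemma C_zero: "0 \<in> C 0"
  using linear_0[OF bounded_linear.linear[OF QT]] by (simp add: C_def K_zero)

lemma C_add:
  assumes "x \<in> C r" "y \<in> C q"
  shows "x + y \<in> C (r + q)"
  unfolding C_def
proof (intro CollectI allI impI)
  fix s :: real assume s: "0 \<le> s"
  then have "(Q (T s x) - r *\<^sub>R v) + (Q (T s y) - q *\<^sub>R v) \<in> K" using assms by (intro K_add) (auto simp: C_def)
  then show "Q (T s (x + y)) - (r + q) *\<^sub>R v \<in> K"
    using linear_add[OF bounded_linear.linear[OF QT[OF s]]] by (simp add: algebra_simps)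
qed

lemma C_scaleR:
  assumes "0 \<le> c" "x \<in> C r"
  shows "c *\<^sub>R x \<in> C (c * r)"
  unfolding C_def
proof (intro CollectI allI impI)
  fix s :: real assume s: "0 \<le> s"
  then have "c *\<^sub>R (Q (T s x) - r *\<^sub>R v) \<in> K" using assms by (intro K_scaleR) (auto simp: C_def)
  then show "Q (T s (c *\<^sub>R x)) - (c * r) *\<^sub>R v \<in> K"
    using linear_scale[OF bounded_linear.linear[OF QT[OF s]]] by (simp add: algebra_simps)
qed

lemma C_T: "0 \<le> t \<Longrightarrow> x \<in> C r \<Longrightarrow> T t x \<in> C r"
  by (simp add: C_def add_left[symmetric])

text \<open>The k-th power of \<open>U\<close> multiplies the level by u^k, and the geometric series
  of levels sums to r / (1 - u). The ratio \<open>u\<close> for levels is independent of the ratio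
  \<open>q\<close> for norms.\<close>

lemma C_neumann:
  assumes U: "strict_contraction U q" and UC: "\<And>r x. x \<in> C r \<Longrightarrow> U x \<in> C (u * r)"
    and u: "0 \<le> u" "u < 1" and x: "x \<in> C r"
  shows "neumann U x \<in> C (r / (1 - u))"
proof (rule C_limit)
  interpret strict_contraction U q by (rule U)
  have pow: "(U ^^ k) x \<in> C (u ^ k * r)" for k
  proof (induction k)
    case (Suc k) then show ?case using UC[OF Suc] by (simp add: mult.assoc)
  qed (simp add: x)
  show "(\<Sum>k<n. (U ^^ k) x) \<in> C (\<Sum>k<n. u ^ k * r)" for n
    by (induction n) (auto simp: C_zero intro: C_add pow)
  show "(\<lambda>n. \<Sum>k<n. (U ^^ k) x) \<longlonglongrightarrow> neumann U x"
    using neumann_sums[of x] by (simp add: sums_def)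
  show "(\<lambda>n. \<Sum>k<n. u ^ k * r) \<longlonglongrightarrow> r / (1 - u)"
    using sums_mult2[OF geometric_sums[of u], of r] u by (simp add: sums_def)
qed

text \<open>The level r / l is the integral of exp(-l t) r over the half line, as expected of - R,
  the Laplace transform of the semigroup where that integral converges.\<close>

definition good :: "real \<Rightarrow> bool"
  where "good l \<longleftrightarrow> (\<exists>R. resolvent_at (generator T) (of_real l) R \<and>
    (\<forall>r. \<forall>x\<in>C r. - R x \<in> C (r / l)))"

text \<open>Integrating over [0, 1] multiplies the level by (1 - exp(-l)) / l, and summing over the
  translates by integers multiplies it by 1 / (1 - exp(-l)); the product is 1 / l.\<close>

lemma good_large:
  assumes l: "0 < l" and q: "0 \<le> q" "q < 1" "\<And>x. norm (rescale (of_real l) T 1 x) \<le> q * norm x"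
  shows "good l"
proof -
  let ?S = "rescale (of_real l) T"
  interpret S: c0_semigroup ?S by (rule rescale)
  have S_eq: "?S t x = exp (- l * t) *\<^sub>R T t x" for t x
    by (simp add: rescale_def scaleR_complexification_def exp_of_real[symmetric] scaleR_conv_of_real mult.commute)
  have R: "resolvent_at (generator T) (of_real l) (\<lambda>x. - S.J (neumann (?S 1) x))"
    using S.resolvent_at_zero[OF q(3,1,2)] by (simp add: resolvent_at_rescale)
  have e1: "exp (- l) < 1" using l by simp
  have JC: "S.J x \<in> C (r * ((1 - exp (- l)) / l))" if x: "x \<in> C r" for x r
    unfolding C_def
  proof (intro CollectI allI impI)
    fix s :: real assume s: "0 \<le> s"
    have "((\<lambda>t. exp (- l * t)) has_integral (- exp (- l * 1) / l - (- exp (- l * 0) / l))) {0..1}"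
      using l by (intro fundamental_theorem_of_calculus)
        (auto simp: has_real_derivative_iff_has_vector_derivative[symmetric] intro!: derivative_eq_intros)
    then have "((\<lambda>t. exp (- l * t)) has_integral (1 - exp (- l)) / l) {0..1}"
      by (simp add: diff_divide_distrib)
    then have "((\<lambda>t. exp (- l * t) *\<^sub>R (r *\<^sub>R v)) has_integral ((1 - exp (- l)) / l) *\<^sub>R (r *\<^sub>R v)) {0..1}"
      by (rule has_integral_linear[OF _ bounded_linear_scaleR_left, unfolded o_def])
    moreover have "((\<lambda>t. Q (T s (?S t x))) has_integral Q (T s (S.J x))) {0..1}"
      using has_integral_linear[OF integrable_integral[OF S.integrable] QT[OF s]] by (simp add: o_def S.J_def)
    ultimately have "((\<lambda>t. Q (T s (?S t x)) - exp (- l * t) *\<^sub>R (r *\<^sub>R v))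
        has_integral Q (T s (S.J x)) - ((1 - exp (- l)) / l) *\<^sub>R (r *\<^sub>R v)) {0..1}"
      by (intro has_integral_diff)
    then have "Q (T s (S.J x)) - ((1 - exp (- l)) / l) *\<^sub>R (r *\<^sub>R v) \<in> K"
    proof (rule has_integral_in_cone[OF _ K_closed _ K_zero K_add K_scaleR])
      fix t :: real assume t: "t \<in> {0..1}"
      have "Q (T s (?S t x)) = exp (- l * t) *\<^sub>R Q (T (s + t) x)"
        using s t linear_scale[OF bounded_linear.linear[OF QT[OF s]]] by (simp add: S_eq add_left)
      moreover have "exp (- l * t) *\<^sub>R (Q (T (s + t) x) - r *\<^sub>R v) \<in> K"
        using x s t by (intro K_scaleR) (auto simp: C_def)
      ultimately show "Q (T s (?S t x)) - exp (- l * t) *\<^sub>R (r *\<^sub>R v) \<in> K"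
        by (simp add: scaleR_diff_right)
    qed
    then show "Q (T s (S.J x)) - (r * ((1 - exp (- l)) / l)) *\<^sub>R v \<in> K" by (simp add: mult.commute)
  qed
  have NC: "neumann (?S 1) x \<in> C (r / (1 - exp (- l)))" if "x \<in> C r" for x r
  proof (rule C_neumann[OF _ _ _ e1 that])
    show "strict_contraction (?S 1) q"
      using q by (intro strict_contraction.intro strict_contraction_axioms.intro S.bounded_linear) auto
    show "?S 1 x \<in> C (exp (- l) * r)" if "x \<in> C r" for r x
      using C_scaleR[OF _ C_T[OF _ that], of "exp (- l)" 1] by (simp add: S_eq)
  qed simp
  have "S.J (neumann (?S 1) x) \<in> C (r / l)" if "x \<in> C r" for x r
    using JC[OF NC[OF that]] e1 l by simp
  then show ?thesis using R unfolding good_def by (intro exI[of _ "\<lambda>x. - S.J (neumann (?S 1) x)"]) simp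
qed

text \<open>Going left, (m - l) R = (l - m)(- R) has a nonnegative coefficient, so \<open>U\<close>
  respects the sets \<open>C r\<close> with ratio (l - m) / l. Then r / (1 - (l - m) / l) / l = r /
  m: the step is exact, and its length is limited only by the norm of the resolvent.\<close>

lemma good_step:
  assumes "good l" and R: "resolvent_at (generator T) (of_real l) R"
    and bound: "\<And>x. norm (R x) \<le> B * norm x" "0 < B" "(l - m) * B \<le> 1 / 2" and m: "0 < m" "m \<le> l"
  shows "good m"
proof -
  obtain R' where "resolvent_at (generator T) (of_real l) R'" "\<And>r x. x \<in> C r \<Longrightarrow> - R' x \<in> C (r / l)"
    using assms(1) unfolding good_def by blast
  then have RC: "\<And>r x. x \<in> C r \<Longrightarrow> - R x \<in> C (r / l)" using resolvent_at_unique[OF R] by blast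
  let ?U = "\<lambda>x. (complex_of_real m - complex_of_real l) *\<^sub>C R x"
  have "cmod (complex_of_real m - complex_of_real l) * B \<le> 1 / 2"
    using bound(3) m by (simp add: norm_of_real of_real_diff[symmetric] del: of_real_diff)
  note pert = resolvent_perturb[OF R bound(1,2) this]
  have "neumann ?U x \<in> C (r / (1 - (l - m) / l))" if "x \<in> C r" for x r
  proof (rule C_neumann[OF pert(1) _ _ _ that])
    fix r x assume "x \<in> C r"
    then have "(l - m) *\<^sub>R (- R x) \<in> C ((l - m) * (r / l))" using m by (intro C_scaleR RC) auto
    then show "?U x \<in> C ((l - m) / l * r)"
      by (simp add: scaleR_complexification_def complexification.scale_left_diff_distrib mult_ac)
  qed (use m in auto)
  then have "- R (neumann ?U x) \<in> C (r / (1 - (l - m) / l) / l)" if "x \<in> C r" for x r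
    using that by (intro RC)
  moreover have "r / (1 - (l - m) / l) / l = r / m" for r
    using m by (simp add: field_simps)
  ultimately have "- R (neumann ?U x) \<in> C (r / m)" if "x \<in> C r" for x r
    using that by (simp only:)
  then show ?thesis using pert(2) unfolding good_def by blast
qed

text \<open>As long as the real axis stays in the resolvent set, the invariance of the cones \<open>C r\<close> under
  the resolvent propagates to the left; at \<open>0\<close> the factor \<open>r / l\<close> blows up whereas the resolvent
  does not.\<close>

lemma neg_in_cone:
  assumes res: "\<And>l. 0 \<le> l \<Longrightarrow> complex_of_real l \<in> resolvent_set (generator T)"
    and x: "x \<in> C 1"
  shows "- v \<in> K"
proof -
  obtain w where w: "\<And>l. w < Re l \<Longrightarrow>
      \<exists>q. 0 \<le> q \<and> q < 1 \<and> (\<forall>x. norm (rescale l T 1 x) \<le> q * norm x)"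
    using rescale_contraction by blast
  have good: "good a" if a: "0 < a" for a
  proof -
    define b where "b = max a (w + 1)"
    have ab: "a \<le> b" "0 < b" "w < b" using a by (auto simp: b_def)
    have "good b"
      using w[of "of_real b"] ab good_large[of b] by auto
    \<comment> \<open>\<open>Bolzano\<close> chains implications over short intervals around each
      point. Near the left end such an interval may reach beyond 0, where the premise 0 < a makes
      the claim vacuous.\<close>
    have "0 < a \<longrightarrow> good b \<longrightarrow> good a"
      using ab(1)
    proof (induction rule: Bolzano)
      case (trans a b c)
      then show ?case by auto
    next
      case (local y)
      then have "0 \<le> y" using a by simp
      then obtain R where R: "resolvent_at (generator T) (of_real y) R"
        using res unfolding resolvent_set_iff by blast
      obtain B where B: "B > 0" "\<And>x. norm (R x) \<le> B * norm x" using resolvent_at_bound[OF R] by blast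
      \<comment> \<open>The constant 4 pays for two perturbations: from y to d, which doubles the
        bound \<open>B\<close>, and from d down to c with the bound 2 B.\<close>
      have "good c" if c: "c \<le> y" "y \<le> d" "d - c < 1 / (4 * B)" "0 < c" "good d" for c d
      proof -
        have dc: "(d - c) * B \<le> 1 / 4" using c(3) B(1) by (simp add: field_simps)
        have "(d - y) * B \<le> (d - c) * B" using c B by (intro mult_right_mono) auto
        then have dy: "cmod (complex_of_real d - complex_of_real y) * B \<le> 1 / 2"
          using dc c(2) by (simp add: of_real_diff[symmetric] del: of_real_diff)
        note pert = resolvent_perturb[OF R B(2,1) dy]
        show ?thesis
          by (rule good_step[OF c(5) pert(2,3)]) (use B c dc in auto)
      qed
      then show ?case using B(1) by (intro exI[of _ "1 / (4 * B)"]) auto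
    qed
    then show ?thesis using a \<open>good b\<close> by blast
  qed
  obtain R0 where R0: "resolvent_at (generator T) (of_real 0) R0"
    using res[of 0] unfolding resolvent_set_iff by auto
  obtain B where B: "B > 0" "\<And>x. norm (R0 x) \<le> B * norm x" using resolvent_at_bound[OF R0] by blast
  \<comment> \<open>A null sequence inside the radius on which the resolvent stays bounded by twice
    its bound at 0.\<close>
  define l where "l n = (1 / (2 * B)) / real (Suc n)" for n
  have l: "0 < l n" for n using B(1) by (simp add: l_def)
  have lB: "l n * B \<le> 1 / 2" for n
  proof -
    have "l n * B = (1 / 2) / real (Suc n)" using B(1) by (simp add: l_def)
    also have "\<dots> \<le> 1 / 2" by (simp add: divide_simps)
    finally show ?thesis .
  qed
  have "\<exists>y. norm y \<le> 2 * B * norm x \<and> y \<in> C (1 / l n)" for n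
  proof -
    have "cmod (complex_of_real (l n) - of_real 0) * B \<le> 1 / 2" using l[of n] lB[of n] by simp
    note pert = resolvent_perturb[OF R0 B(2,1) this]
    obtain R where R: "resolvent_at (generator T) (of_real (l n)) R" "- R x \<in> C (1 / l n)"
      using good[OF l] x unfolding good_def by blast
    have "norm (- R x) \<le> 2 * B * norm x"
      using pert(3)[of x] resolvent_at_unique[OF R(1) pert(2)] by simp
    then show ?thesis using R(2) by blast
  qed
  then obtain y where y: "\<And>n. norm (y n) \<le> 2 * B * norm x" "\<And>n. y n \<in> C (1 / l n)" by metis
  have "l \<longlonglongrightarrow> 0" unfolding l_def by (rule lim_const_over_n[THEN LIMSEQ_Suc])
  then have "(\<lambda>n. l n * (2 * B * norm x)) \<longlonglongrightarrow> 0 * (2 * B * norm x)" by (intro tendsto_intros)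
  then have "(\<lambda>n. l n * (2 * B * norm x)) \<longlonglongrightarrow> 0" by simp
  moreover have "norm (l n *\<^sub>R y n) \<le> l n * (2 * B * norm x)" for n
    using y(1)[of n] l[of n] by simp
  ultimately have lim: "(\<lambda>n. l n *\<^sub>R y n) \<longlonglongrightarrow> 0"
    by (rule Lim_null_comparison[OF always_eventually[OF allI], rotated])
  have mem: "l n *\<^sub>R y n \<in> C 1" for n
    using C_scaleR[OF less_imp_le[OF l] y(2), of n n] l[of n] by simp
  \<comment> \<open>Multiplying \<open>y n\<close> by \<open>l n\<close> restores level 1 but sends
    the vector to 0. At time s = 0, membership of the limit reads - v in \<open>K\<close>.\<close>
  have "0 \<in> C 1" by (rule C_limit[OF mem lim tendsto_const])
  then have "Q (T 0 0) - 1 *\<^sub>R v \<in> K" unfolding C_def by (simp only: mem_Collect_eq order_refl)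
  then show ?thesis using linear_0[OF bounded_linear.linear[OF Q]] by simp
qed

end

section \<open>Real spectral points to the right of an eigenvalue\<close>

context c0_semigroup
begin

lemma real_spectrum_right_of_eigenvalue:
  assumes pos: "\<And>n. positive_operator (P n)"
    and incr: "\<And>n. positive_operator (\<lambda>f. P (Suc n) f - P n f)"
    and lim: "\<And>f. (\<lambda>n. P n f) \<longlonglongrightarrow> f"
    and LEP: "LEP T P"
    and g: "g \<in> fst (generator T)" "snd (generator T) g = l *\<^sub>C g" "g \<noteq> 0"
  shows "\<exists>m\<ge>Re l. complex_of_real m \<in> spectrum (generator T)"
proof (rule ccontr)
  assume "\<not> ?thesis"
  then have res: "\<And>m. Re l \<le> m \<Longrightarrow> complex_of_real m \<in> resolvent_set (generator T)"
    by (auto simp: spectrum_def)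
  have "\<exists>n. P n g \<noteq> 0"
  proof (rule ccontr)
    assume "\<not> ?thesis"
    then have "(\<lambda>n. 0) \<longlonglongrightarrow> g" using lim[of g] by simp
    then show False using g(3) by (simp add: LIMSEQ_const_iff)
  qed
  then obtain n where Pg: "P n g \<noteq> 0" by blast
  have Pc: "bounded_clinear (P n)" by (rule bounded_clinear_of_increasing_positive[OF pos incr lim])
  obtain a b c d where abcd: "a \<in> positive_cone" "b \<in> positive_cone" "c \<in> positive_cone" "d \<in> positive_cone"
    and g_eq: "g = (a - b) + \<i> *\<^sub>C (c - d)"
    using positive_decomposition[of g] by metis
  have PT: "clinear (\<lambda>x. P n (T t x))" if "0 \<le> t" for t
    using pos[of n] bounded_clinear[OF that]
    by (auto simp: positive_operator_def bounded_clinear_def clinear_iff)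
  \<comment> \<open>\<open>LEP\<close> speaks of nonzero vectors only, while some of the four parts
    of \<open>g\<close> may vanish.\<close>
  have LEP_zero: "\<exists>\<tau>\<ge>0. \<forall>t\<ge>\<tau>. P n (T t f) \<in> positive_cone" if f: "f \<in> positive_cone" for f
  proof (cases "f = 0")
    case True
    have "P n (T t 0) = 0" if "0 \<le> t" for t
      using PT[OF that] unfolding clinear_iff by (metis complexification.scale_zero_left)
    then show ?thesis using True by (auto simp: positive_cone_zero)
  next
    case False
    then have "f \<in> positive_cone - {0}" using f by simp
    then have "\<exists>\<tau>>0. \<forall>t\<ge>\<tau>. P n (T t f) \<in> positive_cone"
      using LEP unfolding LEP_def by blast
    then show ?thesis using less_imp_le by blast
  qed
  obtain ta tb tc td where
    ta: "0 \<le> ta" "\<And>t. ta \<le> t \<Longrightarrow> P n (T t a) \<in> positive_cone" and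
    tb: "0 \<le> tb" "\<And>t. tb \<le> t \<Longrightarrow> P n (T t b) \<in> positive_cone" and
    tc: "0 \<le> tc" "\<And>t. tc \<le> t \<Longrightarrow> P n (T t c) \<in> positive_cone" and
    td: "0 \<le> td" "\<And>t. td \<le> t \<Longrightarrow> P n (T t d) \<in> positive_cone"
    using LEP_zero[OF abcd(1)] LEP_zero[OF abcd(2)] LEP_zero[OF abcd(3)] LEP_zero[OF abcd(4)] by metis
  \<comment> \<open>The waiting times are nonnegative, so their sum dominates each of them.\<close>
  define \<tau> where "\<tau> = ta + tb + tc + td"
  define v where "v = Cx (modulus (P n g)) 0"
  define h where "h = a + b + c + d"
  \<comment> \<open>After this rescaling the eigenvalue is purely imaginary, so the modulus of P_n
    (S t g) is the constant |P_n g|.\<close>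
  define S where "S = rescale (of_real (Re l)) T"
  have S_eq: "S t y = exp (- Re l * t) *\<^sub>R T t y" for t y
    by (simp add: S_def rescale_def scaleR_complexification_def exp_of_real[symmetric] scaleR_conv_of_real mult.commute)
  interpret S: c0_semigroup S unfolding S_def by (rule rescale)
  interpret S: cone_bound S "P n" positive_cone v
    by (intro cone_bound.intro cone_bound_axioms.intro S.c0_semigroup_axioms closed_positive_cone
        bounded_clinear_bounded_linear[OF Pc] positive_cone_zero positive_cone_add positive_cone_scaleR)
  have dom: "P n (S t h) - v \<in> positive_cone" if "\<tau> \<le> t" for t
  proof -
    have t: "0 \<le> t" using that ta tb tc td by (simp add: \<tau>_def)
    have cones: "P n (T t a) \<in> positive_cone" "P n (T t b) \<in> positive_cone"
      "P n (T t c) \<in> positive_cone" "P n (T t d) \<in> positive_cone"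
      using that ta tb tc td by (auto simp: \<tau>_def)
    have add: "P n (T t (x + y)) = P n (T t x) + P n (T t y)" for x y
      using PT[OF t] by (simp add: clinear_iff)
    have "P n (T t h) \<in> positive_cone"
      unfolding h_def add by (intro positive_cone_add cones)
    then have im: "im_part (P n (T t h)) = 0" by (simp add: positive_cone_iff)
    have "modulus (P n (T t g)) \<le> re_part (P n (T t h))"
      unfolding g_eq h_def by (rule modulus_le_of_positive_parts[OF cones PT[OF t]])
    moreover have "modulus (P n (T t g)) = exp (t * Re l) *\<^sub>R modulus (P n g)"
      unfolding eigenvector_semigroup[OF g(1,2) t] bounded_clinear_scaleC[OF Pc] modulus_scaleC by simp
    ultimately have "exp (- Re l * t) *\<^sub>R exp (t * Re l) *\<^sub>R modulus (P n g)
        \<le> exp (- Re l * t) *\<^sub>R re_part (P n (T t h))"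
      by (intro scaleR_left_mono) auto
    then have "modulus (P n g) \<le> exp (- Re l * t) *\<^sub>R re_part (P n (T t h))"
      by (simp add: exp_add[symmetric] mult.commute)
    moreover have "P n (S t h) = exp (- Re l * t) *\<^sub>R P n (T t h)"
      unfolding S_eq using linear_scale[OF bounded_linear.linear[OF bounded_clinear_bounded_linear[OF Pc]]]
      by blast
    ultimately show ?thesis using im by (simp add: positive_cone_iff v_def)
  qed
  have \<tau>0: "0 \<le> \<tau>" using ta tb tc td by (simp add: \<tau>_def)
  \<comment> \<open>Membership in \<open>S.C\<close> demands the bound from time 0 on, so the vector
    is first carried beyond the waiting time.\<close>
  have "S \<tau> h \<in> S.C 1"
    using dom \<tau>0 by (simp add: S.C_def S.add_left[symmetric])
  moreover have "complex_of_real m \<in> resolvent_set (generator S)" if "0 \<le> m" for m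
    using res[of "Re l + m"] that unfolding S_def resolvent_set_iff resolvent_at_rescale by simp
  ultimately have "- v \<in> positive_cone" using S.neg_in_cone by blast
  then have "modulus (P n g) = 0"
    by (simp add: positive_cone_iff v_def antisym)
  then have "norm (P n g) = 0" by (simp add: norm_complexification_def)
  then show False using Pg by simp
qed

end

theorem theorem4p3:
  fixes T :: "real \<Rightarrow> 'a::real_banach_lattice complexification \<Rightarrow> 'a complexification"
    and P :: "nat \<Rightarrow> 'a complexification \<Rightarrow> 'a complexification"
  assumes "C0_semigroup T"
    and "\<And>n. positive_operator (P n)"
    and "\<And>n. positive_operator (\<lambda>f. P (Suc n) f - P n f)"
    and "\<And>f. (\<lambda>n. P n f) \<longlonglongrightarrow> f"
    and "LEP T P"
    and "essential_spectral_bound (generator T) < spectral_bound (generator T)"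
  shows "\<exists>s::real. spectral_bound (generator T) = ereal s
           \<and> complex_of_real s \<in> spectrum (generator T)"
proof -
  interpret c0_semigroup T by unfold_locales (rule assms(1))
  let ?A = "generator T"
  obtain w where w: "\<And>l. w < Re l \<Longrightarrow> l \<in> resolvent_set ?A" using half_plane_resolvent_set by blast
  have Re_le: "Re l \<le> w" if "l \<in> spectrum ?A" for l
    using w[of l] that by (force simp: spectrum_def)
  have "spectral_bound ?A \<le> ereal w"
    unfolding spectral_bound_def using Re_le by (intro SUP_least) simp
  \<comment> \<open>The strict inequality of the hypothesis rules out an empty spectrum, and the
    half plane of resolvent points rules out an infinite bound.\<close>
  moreover have "- \<infinity> < spectral_bound ?A" using assms(6) by (rule le_less_trans[rotated]) simp
  ultimately obtain s where s: "spectral_bound ?A = ereal s"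
    by (cases "spectral_bound ?A") auto
  have "\<exists>l\<in>spectrum ?A. dist l (complex_of_real s) < e" if "e > 0" for e
  proof -
    have "max (essential_spectral_bound ?A) (ereal (s - e)) < (SUP \<mu>\<in>spectrum ?A. ereal (Re \<mu>))"
      using assms(6) s \<open>e > 0\<close> by (simp add: spectral_bound_def[symmetric])
    then obtain l1 where l1: "l1 \<in> spectrum ?A"
      "essential_spectral_bound ?A < ereal (Re l1)" "s - e < Re l1"
      unfolding less_SUP_iff by auto
    \<comment> \<open>Parameters of the spectral points on the horizontal ray from
      \<open>l1\<close>. The ray ends up in the half plane of resolvent points, so \<open>D\<close>
      is compact and has a maximum.\<close>
    define D where "D = {t. 0 \<le> t \<and> l1 + complex_of_real t \<in> spectrum ?A}"
    have "D = {0..} \<inter> (\<lambda>t. l1 + complex_of_real t) -` spectrum ?A" by (auto simp: D_def)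
    then have "closed D"
      by (auto intro!: closed_Int closed_vimage closed_spectrum continuous_intros)
    moreover have "D \<subseteq> {0..w - Re l1}" using Re_le by (force simp: D_def)
    then have "bounded D" by (rule bounded_subset[OF bounded_closed_interval])
    ultimately have "compact D" by (simp add: compact_eq_bounded_closed)
    moreover have "0 \<in> D" using l1 by (simp add: D_def)
    ultimately obtain t where t: "t \<in> D" "\<And>u. u \<in> D \<Longrightarrow> u \<le> t"
      using compact_attains_sup[of D] by auto
    define l where "l = l1 + complex_of_real t"
    have l: "l \<in> spectrum ?A" "Re l1 \<le> Re l" using t(1) by (auto simp: D_def l_def)
    have "fredholm (shift_op ?A l)"
    proof (rule ccontr)
      assume "\<not> ?thesis"
      then have "ereal (Re l) \<le> essential_spectral_bound ?A"
        unfolding essential_spectral_bound_def essential_spectrum_def by (intro SUP_upper) simp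
      then show False using l1(2) l(2) by (meson ereal_less_eq(3) leD order_trans)
    qed
    moreover have "\<exists>\<mu>\<in>resolvent_set ?A. cmod (\<mu> - l) < d" if "d > 0" for d
    proof
      have "t + d / 2 \<notin> D" using t(2)[of "t + d / 2"] that by auto
      then show "l + complex_of_real (d / 2) \<in> resolvent_set ?A"
        using t(1) that by (auto simp: D_def l_def spectrum_def add.assoc)
      show "cmod (l + complex_of_real (d / 2) - l) < d" using that by (simp add: norm_divide)
    qed
    ultimately obtain g where "g \<in> fst ?A" "g \<noteq> 0" "snd ?A g = l *\<^sub>C g"
      using fredholm_boundary_eigenvector[OF _ l(1)] by blast
    then obtain m where m: "Re l \<le> m" "complex_of_real m \<in> spectrum ?A"
      using real_spectrum_right_of_eigenvalue[OF assms(2-5)] by blast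
    have "ereal (Re (complex_of_real m)) \<le> spectral_bound ?A"
      unfolding spectral_bound_def by (rule SUP_upper[OF m(2)])
    then have "m \<le> s" by (simp add: s)
    then have "dist (complex_of_real m) (complex_of_real s) < e"
      using m(1) l(2) l1(3) by (simp add: dist_norm of_real_diff[symmetric] del: of_real_diff)
    then show ?thesis using m(2) by blast
  qed
  then have "complex_of_real s \<in> closure (spectrum ?A)" by (simp add: closure_approachable)
  then show ?thesis using s closed_spectrum[of ?A] by simp
qed

end
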